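(* Let $(J,R,Q,B)\in\Sigma_{n,m}$ and $S\in\mathbb{K}^{m\times m}$ with $S^H=S\ge0$. Let $\mu\in\mathbb{K}\setminus\big(\sigma((J-R)Q)\cup\sigma(-((J-R)Q)^H)\big)$ be such that $\mu\mathcal{E}-\mathcal{A}_S$ is invertible. Write, with $n\times n$ blocks, $$e^{-[N_\mu^D(I-\mu N_\mu)](t-t_0)}=\begin{bmatrix}E_1^\mu(t)&E_2^\mu(t)\\ E_3^\mu(t)&E_4^\mu(t)\end{bmatrix},\qquad t\in\mathbb{R}.$$ Assume that $E_3^\mu(t_1)$ is invertible and that $$\begin{bmatrix}E_3^\mu(t_1)^{-1}[x^1-E_4^\mu(t_1)x^0]\\ x^0\end{bmatrix}\in\operatorname{im}(N_\mu^DN_\mu).$$ Then the unique optimal control of the problem $$\min_{u\in L^1([t_0,t_1],\mathbb{K}^m)}\ \frac12\int_{t_0}^{t_1}\big[x(t)^HQRQx(t)+u(t)^HSu(t)\big]\,\mathrm{d}t$$ subject to $\tfrac{\mathrm{d}}{\mathrm{d}t}x(t)=(J-R)Qx(t)+Bu(t)$ for a.e. $t\in[t_0,t_1]$, $x(t_0)=x^0$, $x(t_1)=x^1$, is given by $$u(t)=M_\mu N_\mu^D\,e^{-[N_\mu^D(I-\mu N_\mu)](t-t_0)}\begin{bmatrix}E_3^\mu(t_1)^{-1}[x^1-E_4^\mu(t_1)x^0]\\ x^0\end{bmatrix}\quad\text{for all }t\in[t_0,t_1].$$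
   Context: $\mathbb{K}\in\{\mathbb{R},\mathbb{C}\}$, $n,m$ are positive integers, $t_0<t_1$ are real, $x^0,x^1\in\mathbb{K}^n$, $A^H$ is the conjugate transpose, $\sigma(A)$ is the set of (complex) eigenvalues of $A$, and $A\ge0$ means $x^HAx\ge0$ for all $x$. States $x$ are in $W^{1,1}([t_0,t_1],\mathbb{K}^n)$. $\Sigma_{n,m}$ is the set of all $(J,R,Q,B)\in(\mathbb{K}^{n\times n})^3\times\mathbb{K}^{n\times m}$ with $J=-J^H$, $R=R^H\ge0$, $Q=Q^H\ge0$. The matrices of the optimality system are $$\mathcal{E}=\begin{bmatrix}0_{n\times n}&I_n&0_{n\times m}\\-I_n&0_{n\times n}&0_{n\times m}\\0_{m\times n}&0_{m\times n}&0_{m\times m}\end{bmatrix},\qquad \mathcal{A}_S=\begin{bmatrix}0_{n\times n}&(J-R)Q&B\\((J-R)Q)^H&QRQ&0_{n\times m}\\ B^H&0_{m\times n}&S\end{bmatrix}.$$ For $\mu$ as in the claim, $$E_\mu:=\begin{bmatrix}0&(J-R)Q-\mu I\\((J-R)Q)^H+\mu I&QRQ\end{bmatrix}^{-1},\qquad S_\mu:=S-\begin{bmatrix}B^H&0\end{bmatrix}E_\mu\begin{bmatrix}B\\0\end{bmatrix},$$ $$N_\mu:=\left(E_\mu+E_\mu\begin{bmatrix}B\\0\end{bmatrix}S_\mu^{-1}\begin{bmatrix}B^H&0\end{bmatrix}E_\mu\right)\begin{bmatrix}0&-I\\ I&0\end{bmatrix},\qquad M_\mu:=-S_\mu^{-1}\begin{bmatrix}B^H&0\end{bmatrix}E_\mu\begin{bmatrix}0&-I\\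 I&0\end{bmatrix}$$ ($S_\mu$ is invertible whenever $\mu\mathcal{E}-\mathcal{A}_S$ is). The Drazin inverse $M^D$ of a square matrix $M$ is the unique matrix with $M^DM=MM^D$, $M^DMM^D=M^D$ and $M^DM^{\nu+1}=M^\nu$ for some $\nu\in\mathbb{N}_0$. *)

theory Defs
  imports "HOL-Analysis.Analysis"
begin

text \<open>
  The scalar field is a set \<open>K\<close> of complex numbers, equal to \<open>\<real>\<close> or to \<open>UNIV\<close>. Vectors and matrices
  have complex entries and are confined to \<open>K\<close> by membership in \<open>vecs K\<close>, \<open>mats K\<close>.
  Block vectors and matrices are indexed by sum types.
\<close>

definition vecs :: "complex set \<Rightarrow> (complex^'n) set" where
  "vecs K = {v. \<forall>i. v $ i \<in> K}"

definition mats :: "complex set \<Rightarrow> (complex^'c^'r) set" where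
  "mats K = {A. \<forall>i j. A $ i $ j \<in> K}"

definition ctranspose :: "complex^'c^'r \<Rightarrow> complex^'r^'c" where
  "ctranspose A = map_matrix cnj (transpose A)"

text \<open>\<open>cinner x y\<close> is \<open>x\<^sup>Hy\<close>, conjugate linear in the first argument.\<close>

definition cinner :: "complex^'n \<Rightarrow> complex^'n \<Rightarrow> complex" where
  "cinner x y = (\<Sum>i\<in>UNIV. cnj (x $ i) * y $ i)"

definition psd :: "complex set \<Rightarrow> complex^'n^'n \<Rightarrow> bool" where
  "psd K A \<longleftrightarrow> (\<forall>x\<in>vecs K. cinner x (A *v x) \<in> \<real>\<^sub>\<ge>\<^sub>0)"

text \<open>All complex eigenvalues, also for \<open>K = \<real>\<close>.\<close>

definition spectrum :: "complex^'n^'n \<Rightarrow> complex set" where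
  "spectrum A = {c. \<exists>v. v \<noteq> 0 \<and> A *v v = c *s v}"

text \<open>A matrix is a vector of rows, so \<open>vstack\<close> stacks vectors as well as matrices.\<close>

definition vstack :: "'a^'r \<Rightarrow> 'a^'s \<Rightarrow> 'a^('r + 's)" where
  "vstack a b = (\<chi> i. case i of Inl r \<Rightarrow> a $ r | Inr s \<Rightarrow> b $ s)"

definition hstack :: "'a^'c^'r \<Rightarrow> 'a^'d^'r \<Rightarrow> 'a^('c + 'd)^'r" where
  "hstack A B = (\<chi> i. vstack (A $ i) (B $ i))"

definition block_lower_left :: "'a^('c::finite + 'd::finite)^('r::finite + 's::finite) \<Rightarrow> 'a^'c^'s" where
  "block_lower_left M = (\<chi> i j. M $ Inr i $ Inl j)"

definition block_lower_right :: "'a^('c::finite + 'd::finite)^('r::finite + 's::finite) \<Rightarrow> 'a^'d^'s" where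
  "block_lower_right M = (\<chi> i j. M $ Inr i $ Inr j)"

definition mpow :: "complex^'n^'n \<Rightarrow> nat \<Rightarrow> complex^'n^'n" where
  "mpow A k = (((**) A) ^^ k) (mat 1)"

definition mexp :: "complex^'n^'n \<Rightarrow> complex^'n^'n" where
  "mexp A = (\<Sum>k. (1 / fact k) *\<^sub>R mpow A k)"

definition drazin :: "complex^'n^'n \<Rightarrow> complex^'n^'n" where
  "drazin M = (THE X. X ** M = M ** X \<and> X ** M ** X = X \<and>
                 (\<exists>\<nu>. X ** mpow M (Suc \<nu>) = mpow M \<nu>))"

definition Sigma_set ::
  "complex set \<Rightarrow> ((complex^'n^'n) \<times> (complex^'n^'n) \<times> (complex^'n^'n) \<times> (complex^'m^'n)) set" where
  "Sigma_set K = {(J, R, Q, B).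
     J \<in> mats K \<and> R \<in> mats K \<and> Q \<in> mats K \<and> B \<in> mats K \<and>
     J = - ctranspose J \<and> R = ctranspose R \<and> psd K R \<and> Q = ctranspose Q \<and> psd K Q}"

definition E_opt :: "complex^('n::finite + 'n + 'm::finite)^('n + 'n + 'm)" where
  "E_opt =
     vstack (hstack 0 (hstack (mat 1) 0))
    (vstack (hstack (- mat 1) (hstack 0 0))
            (hstack 0 (hstack 0 0)))"

definition A_opt :: "complex^'n^'n \<Rightarrow> complex^'n^'n \<Rightarrow> complex^'n^'n \<Rightarrow> complex^'m^'n \<Rightarrow>
    complex^'m^'m \<Rightarrow> complex^('n + 'n + 'm)^('n + 'n + 'm)" where
  "A_opt J R Q B S =
     vstack (hstack 0 (hstack ((J - R) ** Q) B))
    (vstack (hstack (ctranspose ((J - R) ** Q)) (hstack (Q ** R ** Q) 0))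
            (hstack (ctranspose B) (hstack 0 S)))"

definition E_mu :: "complex^'n^'n \<Rightarrow> complex^'n^'n \<Rightarrow> complex^'n^'n \<Rightarrow> complex \<Rightarrow>
    complex^('n + 'n)^('n + 'n)" where
  "E_mu J R Q \<mu> = matrix_inv
     (vstack (hstack 0 ((J - R) ** Q - mat \<mu>))
             (hstack (ctranspose ((J - R) ** Q) + mat \<mu>) (Q ** R ** Q)))"

definition S_mu :: "complex^'n^'n \<Rightarrow> complex^'n^'n \<Rightarrow> complex^'n^'n \<Rightarrow> complex^'m^'n \<Rightarrow>
    complex^'m^'m \<Rightarrow> complex \<Rightarrow> complex^'m^'m" where
  "S_mu J R Q B S \<mu> = S - hstack (ctranspose B) 0 ** E_mu J R Q \<mu> ** vstack B 0"

definition skew_unit :: "complex^('n::finite + 'n)^('n + 'n)" where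
  "skew_unit = vstack (hstack 0 (- mat 1)) (hstack (mat 1) 0)"

definition N_mu :: "complex^'n^'n \<Rightarrow> complex^'n^'n \<Rightarrow> complex^'n^'n \<Rightarrow> complex^'m^'n \<Rightarrow>
    complex^'m^'m \<Rightarrow> complex \<Rightarrow> complex^('n + 'n)^('n + 'n)" where
  "N_mu J R Q B S \<mu> =
     (E_mu J R Q \<mu> + E_mu J R Q \<mu> ** vstack B 0 ** matrix_inv (S_mu J R Q B S \<mu>)
        ** hstack (ctranspose B) 0 ** E_mu J R Q \<mu>) ** skew_unit"

definition M_mu :: "complex^'n^'n \<Rightarrow> complex^'n^'n \<Rightarrow> complex^'n^'n \<Rightarrow> complex^'m^'n \<Rightarrow>
    complex^'m^'m \<Rightarrow> complex \<Rightarrow> complex^('n + 'n)^'m" where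
  "M_mu J R Q B S \<mu> =
     - (matrix_inv (S_mu J R Q B S \<mu>) ** hstack (ctranspose B) 0 ** E_mu J R Q \<mu> ** skew_unit)"

definition L1 :: "complex set \<Rightarrow> real \<Rightarrow> real \<Rightarrow> (real \<Rightarrow> complex^'m) set" where
  "L1 K a b = {u. u absolutely_integrable_on {a..b} \<and> (\<forall>t\<in>{a..b}. u t \<in> vecs K)}"

text \<open>Weak derivative on \<open>(a,b)\<close>, with scalar \<open>C\<^sup>1\<close> test functions of compact support in \<open>(a,b)\<close>.\<close>

definition has_weak_derivative ::
  "(real \<Rightarrow> 'a::euclidean_space) \<Rightarrow> (real \<Rightarrow> 'a) \<Rightarrow> real \<Rightarrow> real \<Rightarrow> bool" where
  "has_weak_derivative x g a b \<longleftrightarrow>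
     (\<forall>\<phi> :: real \<Rightarrow> real. \<phi> C1_differentiable_on UNIV \<longrightarrow> closure {t. \<phi> t \<noteq> 0} \<subseteq> {a<..<b} \<longrightarrow>
        integral {a..b} (\<lambda>t. deriv \<phi> t *\<^sub>R x t) = - integral {a..b} (\<lambda>t. \<phi> t *\<^sub>R g t))"

text \<open>
  Elements of \<open>W\<^sup>1\<^sup>,\<^sup>1\<close> are represented by their continuous representative on \<open>[a,b]\<close>, so that point
  evaluations make sense.
\<close>

definition W11 :: "complex set \<Rightarrow> real \<Rightarrow> real \<Rightarrow> (real \<Rightarrow> complex^'n) set" where
  "W11 K a b = {x \<in> L1 K a b. continuous_on {a..b} x \<and>
                  (\<exists>g\<in>L1 K a b. has_weak_derivative x g a b)}"

definition feasible :: "complex set \<Rightarrow> real \<Rightarrow> real \<Rightarrow> complex^'n \<Rightarrow> complex^'n \<Rightarrow>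
    complex^'n^'n \<Rightarrow> complex^'n^'n \<Rightarrow> complex^'n^'n \<Rightarrow> complex^'m^'n \<Rightarrow>
    (real \<Rightarrow> complex^'n) \<Rightarrow> (real \<Rightarrow> complex^'m) \<Rightarrow> bool" where
  "feasible K t0 t1 x0 x1 J R Q B x u \<longleftrightarrow>
     u \<in> L1 K t0 t1 \<and> x \<in> W11 K t0 t1 \<and>
     (\<exists>dx\<in>L1 K t0 t1. has_weak_derivative x dx t0 t1 \<and>
        (AE t in lebesgue_on {t0..t1}. dx t = ((J - R) ** Q) *v x t + B *v u t)) \<and>
     x t0 = x0 \<and> x t1 = x1"

text \<open>
  For a control that is merely \<open>L\<^sup>1\<close> the cost may be infinite, so it takes values in \<open>[0,\<infinity>]\<close>. The
  integrand is real and nonnegative when \<open>R\<close>, \<open>Q\<close>, \<open>S\<close> are Hermitian and \<open>R\<close>, \<open>S\<close> are positive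
  semidefinite, so \<open>Re\<close> and \<open>ennreal\<close> lose nothing.
\<close>

definition cost :: "real \<Rightarrow> real \<Rightarrow> complex^'n^'n \<Rightarrow> complex^'n^'n \<Rightarrow> complex^'m^'m \<Rightarrow>
    (real \<Rightarrow> complex^'n) \<Rightarrow> (real \<Rightarrow> complex^'m) \<Rightarrow> ennreal" where
  "cost t0 t1 R Q S x u =
     1 / 2 * (\<integral>\<^sup>+t. ennreal (Re (cinner (x t) ((Q ** R ** Q) *v x t) + cinner (u t) (S *v u t)))
                \<partial>lebesgue_on {t0..t1})"

definition optimal_control :: "complex set \<Rightarrow> real \<Rightarrow> real \<Rightarrow> complex^'n \<Rightarrow> complex^'n \<Rightarrow>
    complex^'n^'n \<Rightarrow> complex^'n^'n \<Rightarrow> complex^'n^'n \<Rightarrow> complex^'m^'n \<Rightarrow> complex^'m^'m \<Rightarrow>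
    (real \<Rightarrow> complex^'m) \<Rightarrow> bool" where
  "optimal_control K t0 t1 x0 x1 J R Q B S u \<longleftrightarrow>
     (\<exists>x. feasible K t0 t1 x0 x1 J R Q B x u \<and>
        (\<forall>y v. feasible K t0 t1 x0 x1 J R Q B y v \<longrightarrow>
           cost t0 t1 R Q S x u \<le> cost t0 t1 R Q S y v))"

end

theory Submission
  imports Defs
begin

text \<open>
  The control problem is convex, so the optimality system is sufficient. Put \<open>A = (J - R)Q\<close> and
  \<open>W = QRQ\<close>. If a state \<open>x\<close>, a control \<open>u\<close> and an adjoint state \<open>l\<close> satisfy
  \[ x' = Ax + Bu, \qquad l' = -A^H l - Wx, \qquad B^H l + Su = 0, \]
  then the cost of a competitor \<open>(y, v)\<close> is the cost of \<open>(x, u)\<close>, plus a cross term, plus the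
  nonnegative cost of the difference \<open>(y - x, v - u)\<close>. The cross term is the integral of the
  derivative of the real part of \<open>-(y - x)\<^sup>Hl\<close>, which is zero because the two states have the same end
  points. This is the lemma \<open>lq_verification\<close>; it needs integration by parts for weakly differentiable functions.

  The matrices \<open>N\<^sub>\<mu>\<close> and \<open>M\<^sub>\<mu>\<close> arise when the optimality system is solved for its undifferentiated
  variables: with \<open>z = (l, x)\<close> it reads \<open>z = -N\<^sub>\<mu>(z' - \<mu>z)\<close>, \<open>u = -M\<^sub>\<mu>(z' - \<mu>z)\<close>
  (\<open>optimality_dae_iff\<close>). If \<open>D\<close> is the Drazin inverse of \<open>N\<^sub>\<mu>\<close>, the flow of \<open>-D(I - \<mu>N\<^sub>\<mu>)\<close> preserves
  the image of \<open>DN\<^sub>\<mu>\<close>, and on that image \<open>z' - \<mu>z = -Dz\<close>; hence \<open>z\<close> solves the first equation and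
  the second one becomes \<open>u = M\<^sub>\<mu>Dz\<close>, the control in the claim (\<open>drazin_flow\<close>). The initial vector is
  chosen such that the lower half of \<open>z\<close> runs from \<open>x0\<close> to \<open>x1\<close>.

  For uniqueness, the difference from a competitor with the same cost has cost zero, hence
  \<open>W(y - x) = 0\<close> and \<open>S(v - u) = 0\<close> almost everywhere. Then \<open>(0, y - x, v - u)\<close> is a solution of the homogeneous
  optimality system that vanishes at \<open>t0\<close>. Since the pencil is regular it is zero: this is
  \<open>homogeneous_dae_zero\<close>, an induction that lowers the power of \<open>N\<^sub>\<mu>\<close> known to annihilate
  the solution.

  That everything stays real for real data is obtained from the observation that inverses and Drazin
  inverses are real polynomials in the matrix (\<open>power_recurrence\<close>).
\<close>

section \<open>Matrix powers and scalar fields\<close>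

lemma matrix_inv_right: "invertible A \<Longrightarrow> A ** matrix_inv A = mat 1"
  and matrix_inv_left: "invertible A \<Longrightarrow> matrix_inv A ** A = mat 1"
  unfolding invertible_def matrix_inv_def by (metis (mono_tags, lifting) someI_ex)+

lemma matrix_inv_unique:
  fixes A :: "'a::semiring_1^'n^'n"
  assumes "A ** X = mat 1" "X ** A = mat 1"
  shows "matrix_inv A = X"
  by (metis assms invertible_def matrix_inv_left matrix_mul_assoc matrix_mul_lid matrix_mul_rid)

lemma linear_matrix_mult_left: "linear (\<lambda>X. A ** X)" for A :: "complex^'b^'c"
  by (rule linearI) (auto simp: matrix_matrix_mult_def vec_eq_iff scaleR_sum_right sum.distrib algebra_simps)

lemma linear_matrix_mult_right: "linear (\<lambda>X. X ** A)" for A :: "complex^'b^'c"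
  by (rule linearI) (auto simp: matrix_matrix_mult_def vec_eq_iff scaleR_sum_right sum.distrib algebra_simps)

lemma mpow_0 [simp]: "mpow A 0 = mat 1"
  and mpow_Suc: "mpow A (Suc k) = A ** mpow A k"
  by (simp_all add: mpow_def)

lemma mpow_add: "mpow A (j + k) = mpow A j ** mpow A k"
  by (induction j) (simp_all add: mpow_Suc matrix_mul_assoc)

lemma mpow_commute:
  assumes "X ** A = A ** X" 
  shows "X ** mpow A k = mpow A k ** X"
  by (induction k) (simp_all add: mpow_Suc matrix_mul_assoc assms, metis assms matrix_mul_assoc)

lemma mpow_mult:
  assumes "X ** A = A ** X"
  shows "mpow (A ** X) k = mpow A k ** mpow X k"
proof (induction k)
  case (Suc k)
  have "X ** mpow A k = mpow A k ** X"
    by (rule mpow_commute[OF assms])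
  then show ?case
    by (simp add: mpow_Suc Suc) (metis matrix_mul_assoc)
qed simp

lemma mat_vec: "mat c *v v = c *s v" for v :: "complex^'n"
  by (simp add: mat_def matrix_vector_mult_def vec_eq_iff if_distrib[of "\<lambda>x. x * _"] cong: if_cong)

lemma mat_commute: "mat c ** A = A ** mat c" for A :: "complex^'n^'n"
  by (simp add: mat_def matrix_matrix_mult_def vec_eq_iff mult.commute
      if_distrib[of "\<lambda>x. x * _"] if_distrib[of "\<lambda>x. _ * x"] cong: if_cong)

lemma mat_vec_commute: "A *v (mat c *v v) = mat c *v (A *v v)" for A :: "complex^'n^'n"
  by (simp add: matrix_vector_mul_assoc mat_commute)

lemma bounded_linear_matrix_mult_left: "bounded_linear (\<lambda>X. A ** X)" for A :: "complex^'b^'c"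
  using linear_matrix_mult_left by (simp add: linear_conv_bounded_linear)

lemma bounded_linear_matrix_mult_right: "bounded_linear (\<lambda>X. X ** A)" for A :: "complex^'b^'c"
  using linear_matrix_mult_right by (simp add: linear_conv_bounded_linear)

lemma bounded_linear_matrix_vec: "bounded_linear (\<lambda>X. X *v v)" for v :: "complex^'b"
proof -
  have "linear (\<lambda>X::complex^'b^'c. X *v v)"
    by (rule linearI) (auto simp: matrix_vector_mult_def vec_eq_iff scaleR_sum_right sum.distrib algebra_simps)
  then show ?thesis by (simp add: linear_conv_bounded_linear)
qed

lemma Reals_scaleR: "z \<in> \<real> \<Longrightarrow> r *\<^sub>R z \<in> \<real>" for z :: complex
  by (simp add: scaleR_conv_of_real)

lemma subspace_vecs: "K = \<real> \<or> K = UNIV \<Longrightarrow> subspace (vecs K)"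
  by (auto simp: subspace_def vecs_def Reals_scaleR)

lemma subspace_mats: "K = \<real> \<or> K = UNIV \<Longrightarrow> subspace (mats K)"
  by (auto simp: subspace_def mats_def Reals_scaleR)

lemma mats_mult: "K = \<real> \<or> K = UNIV \<Longrightarrow> A \<in> mats K \<Longrightarrow> B \<in> mats K \<Longrightarrow> A ** B \<in> mats K"
  by (auto simp: mats_def matrix_matrix_mult_def intro!: sum_in_Reals Reals_mult)

lemma mats_mult_vec: "K = \<real> \<or> K = UNIV \<Longrightarrow> A \<in> mats K \<Longrightarrow> v \<in> vecs K \<Longrightarrow> A *v v \<in> vecs K"
  by (auto simp: mats_def vecs_def matrix_vector_mult_def intro!: sum_in_Reals Reals_mult)

lemma mats_mat: "K = \<real> \<or> K = UNIV \<Longrightarrow> c \<in> K \<Longrightarrow> mat c \<in> mats K"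
  by (auto simp: mats_def mat_def)

lemma mats_mpow: "K = \<real> \<or> K = UNIV \<Longrightarrow> A \<in> mats K \<Longrightarrow> mpow A k \<in> mats K"
  by (induction k) (auto simp: mpow_Suc intro!: mats_mult mats_mat)

lemma mats_ctranspose: "K = \<real> \<or> K = UNIV \<Longrightarrow> A \<in> mats K \<Longrightarrow> ctranspose A \<in> mats K"
  by (auto simp: mats_def ctranspose_def transpose_def) (metis Reals_cases Reals_of_real complex_cnj_complex_of_real)

lemma mats_vstack: "A \<in> mats K \<Longrightarrow> B \<in> mats K \<Longrightarrow> vstack A B \<in> mats K"
  by (auto simp: mats_def vstack_def split: sum.split)

lemma mats_hstack: "A \<in> mats K \<Longrightarrow> B \<in> mats K \<Longrightarrow> hstack A B \<in> mats K"
  by (auto simp: mats_def vstack_def hstack_def split: sum.split)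

section \<open>Inverse and Drazin inverse as real polynomials in the matrix\<close>

text \<open>The spans of \<open>{M\<^sup>j | j \<ge> k}\<close> form a decreasing chain of real vector spaces, so the dimensions
  become stationary, and then \<open>M\<^sup>k\<close> lies in the span of the higher powers. The span is taken over the
  reals, not over the complex numbers: thus \<open>C\<close> is a real polynomial in \<open>M\<close> and is real if \<open>M\<close> is.\<close>

lemma power_recurrence:
  fixes M :: "complex^'n^'n"
  shows "\<exists>k C. mpow M k = mpow M (Suc k) ** C \<and> C \<in> span (range (mpow M))"
proof -
  define U where "U k = span (mpow M ` {k..})" for k
  \<comment> \<open>A least dimension is attained, and from there on the chain is constant.\<close>
  obtain k where k: "\<And>j. dim (U k) \<le> dim (U j)"
    using ex_has_least_nat[of "\<lambda>_. True" 0 "\<lambda>k. dim (U k)"] by auto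
  have "U (Suc k) = U k"
    using k by (intro subspace_dim_equal) (auto simp: U_def intro!: span_mono)
  moreover have "mpow M k \<in> U k"
    by (auto simp: U_def intro: span_base)
  moreover have "mpow M ` {Suc k..} = (\<lambda>X. mpow M (Suc k) ** X) ` range (mpow M)"
  proof -
    have "{Suc k..} = range (\<lambda>i. Suc k + i)"
      by (auto simp: le_iff_add)
    then show ?thesis
      by (simp add: image_image mpow_add[symmetric] del: add_Suc)
  qed
  then have "U (Suc k) = (\<lambda>X. mpow M (Suc k) ** X) ` span (range (mpow M))"
    unfolding U_def by (simp only: linear_span_image[OF linear_matrix_mult_left])
  ultimately show ?thesis
    by (metis imageE)
qed

lemma span_mpow_commute:
  assumes "C \<in> span (range (mpow M))" "X ** M = M ** X"
  shows "X ** C = C ** X"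
  using assms(1)
proof (induction rule: span_induct)
  case base
  show ?case
    by (auto simp: subspace_def matrix_add_ldistrib linear_cmul[OF linear_matrix_mult_left] linear_cmul[OF linear_matrix_mult_right]
       linear_add[OF linear_matrix_mult_right])
next
  case (step x)
  then show ?case using mpow_commute[OF assms(2)] by auto
qed

lemma span_mpow_mats:
  assumes "K = \<real> \<or> K = UNIV" "M \<in> mats K" "C \<in> span (range (mpow M))"
  shows "C \<in> mats K"
  using span_minimal[OF _ subspace_mats[OF assms(1)], of "range (mpow M)"] mats_mpow[OF assms(1,2)] assms(3) by blast

text \<open>If \<open>M\<close> is invertible, then \<open>M\<^sup>k\<close> can be cancelled from \<open>M\<^sup>k = M\<^sup>k\<^sup>+\<^sup>1C\<close>, so \<open>C\<close> is the inverse.\<close>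

lemma matrix_inv_mats:
  fixes M :: "complex^'n^'n"
  assumes K: "K = \<real> \<or> K = UNIV" and M: "M \<in> mats K" "invertible M"
  shows "matrix_inv M \<in> mats K"
proof -
  obtain k C where C: "mpow M k = mpow M (Suc k) ** C" "C \<in> span (range (mpow M))"
    using power_recurrence by blast
  \<comment> \<open>Invertibility is used to cancel the powers of \<open>M\<close> one factor at a time.\<close>
  have cancel: "X = Y" if "mpow M j ** X = mpow M j ** Y" for j X Y
    using that
  proof (induction j arbitrary: X Y)
    case (Suc j)
    have "mpow M (Suc j) = mpow M j ** M"
      using mpow_commute[of M M j] by (simp add: mpow_Suc)
    then have "M ** X = M ** Y"
      using Suc by (metis matrix_mul_assoc)
    then show ?case
      by (metis matrix_inv_left[OF M(2)] matrix_mul_assoc matrix_mul_lid)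
  qed simp
  have "mpow M (Suc k) ** C = mpow M k ** (M ** C)"
    using mpow_commute[of M M k] by (simp add: mpow_Suc matrix_mul_assoc)
  then have "mpow M k ** mat 1 = mpow M k ** (M ** C)"
    using C(1) by simp
  then have "M ** C = mat 1"
    using cancel by metis
  then have "matrix_inv M = C"
    using span_mpow_commute[OF C(2), of M] by (intro matrix_inv_unique) auto
  then show ?thesis
    using span_mpow_mats[OF K M(1) C(2)] by simp
qed

lemma mpow_recurrence_iterate:
  assumes "mpow M k = mpow M (Suc k) ** C" and "C ** M = M ** C"
  shows "mpow M k = mpow M (k + j) ** mpow C j"
proof (induction j)
  case (Suc j)
  have "mpow M (k + j) = mpow M j ** mpow M k"
    by (simp add: mpow_add[symmetric] add.commute)
  also have "\<dots> = mpow M (Suc (k + j)) ** C"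
    by (subst assms(1)) (simp add: matrix_mul_assoc mpow_add[symmetric] add.commute)
  finally show ?case
    using Suc by (simp add: mpow_Suc matrix_mul_assoc)
qed simp

text \<open>The three conditions under the definite description in \<^const>\<open>drazin\<close>. They have to be shown to
  determine \<open>X\<close> before anything can be said about \<^const>\<open>drazin\<close>.\<close>

definition is_drazin :: "complex^'n^'n \<Rightarrow> complex^'n^'n \<Rightarrow> bool" where
  "is_drazin M X \<longleftrightarrow> X ** M = M ** X \<and> X ** M ** X = X \<and> (\<exists>\<nu>. X ** mpow M (Suc \<nu>) = mpow M \<nu>)"

text \<open>For two Drazin inverses, \<open>MX\<close> and \<open>MY\<close> are commuting idempotents that absorb each other, hence are
  equal; and \<open>X = X(MX)\<close> is recovered from \<open>MX\<close>.\<close>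

lemma is_drazin_unique:
  assumes "is_drazin M X" "is_drazin M Y"
  shows "X = Y"
proof -
  \<comment> \<open>\<open>MX\<close> is idempotent, hence equals \<open>M\<^sup>\<nu>\<^sup>+\<^sup>1X\<^sup>\<nu>\<^sup>+\<^sup>1\<close>, to which the defining relation of the other inverse applies.\<close>
  have pw: "mpow (M ** X) (Suc k) = M ** X" if "is_drazin M X" for X k
  proof (induction k)
    case (Suc k)
    have "M ** X ** (M ** X) = M ** X"
      using that unfolding is_drazin_def by (metis matrix_mul_assoc)
    with Suc show ?case by (metis mpow_Suc)
  qed (simp add: mpow_Suc)
  have absorb: "M ** X = M ** Y ** (M ** X)" if X: "is_drazin M X" and Y: "is_drazin M Y" for X Y
  proof -
    obtain \<nu> where nu: "Y ** mpow M (Suc \<nu>) = mpow M \<nu>"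
      using Y by (auto simp: is_drazin_def)
    have "M ** Y ** mpow M (Suc \<nu>) = mpow M (Suc \<nu>)"
      using nu by (metis matrix_mul_assoc mpow_Suc)
    moreover have "M ** X = mpow M (Suc \<nu>) ** mpow X (Suc \<nu>)"
      using pw[OF X, of \<nu>] mpow_mult[of X M "Suc \<nu>"] X by (simp add: is_drazin_def)
    ultimately show ?thesis
      by (metis matrix_mul_assoc)
  qed
  have "M ** X = M ** Y ** (M ** X)" "M ** Y = M ** X ** (M ** Y)"
    using absorb assms by blast+
  moreover have "X ** M = M ** X" "Y ** M = M ** Y" "X ** M ** X = X" "Y ** M ** Y = Y"
    using assms by (auto simp: is_drazin_def)
  moreover have "(M ** X) ** (M ** Y) = (M ** Y) ** (M ** X)"
  proof -
    obtain \<nu> where nu: "Y ** mpow M (Suc \<nu>) = mpow M \<nu>"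
      using assms(2) by (auto simp: is_drazin_def)
    have YM: "Y ** M = M ** Y" using assms by (simp add: is_drazin_def)
    have "mpow M (Suc \<nu>) ** (M ** Y) = (M ** Y) ** mpow M (Suc \<nu>)"
      using mpow_commute[of "M ** Y" M "Suc \<nu>"] YM by (metis matrix_mul_assoc)
    also have "\<dots> = mpow M (Suc \<nu>)" using nu by (metis matrix_mul_assoc mpow_Suc)
    finally have a: "mpow M (Suc \<nu>) ** (M ** Y) = mpow M (Suc \<nu>)" .
    have "M ** X = mpow X (Suc \<nu>) ** mpow M (Suc \<nu>)"
      using pw[OF assms(1), of \<nu>] mpow_mult[of M X "Suc \<nu>"] assms(1) by (simp add: is_drazin_def)
    then have "M ** X ** (M ** Y) = M ** X"
      using a by (metis matrix_mul_assoc)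
    then show ?thesis using absorb[OF assms] by simp
  qed
  ultimately show "X = Y"
    by (metis matrix_mul_assoc)
qed

text \<open>From \<open>M\<^sup>k = M\<^sup>k\<^sup>+\<^sup>1C\<close> with \<open>C\<close> a polynomial in \<open>M\<close> one gets \<open>M\<^sup>k = M\<^sup>2\<^sup>k\<^sup>+\<^sup>1C\<^sup>k\<^sup>+\<^sup>1\<close>, which says that
  \<open>X = M\<^sup>kC\<^sup>k\<^sup>+\<^sup>1\<close> satisfies \<open>XM\<^sup>k\<^sup>+\<^sup>1 = M\<^sup>k\<close>.\<close>

lemma drazin_exists:
  assumes "K = \<real> \<or> K = UNIV" "M \<in> mats K"
  shows "\<exists>X\<in>mats K. is_drazin M X"
proof -
  obtain k C where C: "mpow M k = mpow M (Suc k) ** C" "C \<in> span (range (mpow M))"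
    using power_recurrence by blast
  have CM: "C ** M = M ** C"
    using span_mpow_commute[OF C(2), of M] by simp
  define X where "X = mpow M k ** mpow C (Suc k)"
  have MkC: "mpow M i ** mpow C j = mpow C j ** mpow M i" for i j
    by (metis CM mpow_commute)
  have XM: "X ** M = M ** X"
  proof -
    have "mpow C (Suc k) ** M = M ** mpow C (Suc k)" "mpow M k ** M = M ** mpow M k"
      using mpow_commute[of M C "Suc k"] mpow_commute[of M M k] CM by auto
    then show ?thesis unfolding X_def by (metis matrix_mul_assoc)
  qed
  have X1: "X ** mpow M (Suc k) = mpow M k"
  proof -
    have "X ** mpow M (Suc k) = mpow M k ** mpow M (Suc k) ** mpow C (Suc k)"
      unfolding X_def by (metis MkC matrix_mul_assoc)
    also have "\<dots> = mpow M (k + Suc k) ** mpow C (Suc k)"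
      by (simp only: mpow_add)
    also have "\<dots> = mpow M k"
      using mpow_recurrence_iterate[OF C(1) CM, of "Suc k"] by (rule sym)
    finally show ?thesis .
  qed
  moreover have "X ** M ** X = X"
  proof -
    have "X ** M ** X = X ** mpow M (Suc k) ** mpow C (Suc k)"
      unfolding X_def by (simp add: mpow_Suc matrix_mul_assoc)
    also have "\<dots> = X"
      by (subst X1) (simp add: X_def)
    finally show ?thesis .
  qed
  moreover have "X \<in> mats K"
    unfolding X_def by (intro mats_mult mats_mpow assms span_mpow_mats[OF assms C(2)])
  ultimately show ?thesis
    using XM unfolding is_drazin_def by blast
qed

lemma drazin_mats:
  assumes "K = \<real> \<or> K = UNIV" "M \<in> mats K"
  shows "drazin M \<in> mats K"
  using drazin_exists[OF assms] is_drazin_unique unfolding drazin_def is_drazin_def[symmetric]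
  by (metis the_equality)

lemma drazin_properties:
  fixes M :: "complex^'n^'n"
  shows "drazin M ** M = M ** drazin M" "drazin M ** M ** drazin M = drazin M"
proof -
  obtain X where "is_drazin M X" using drazin_exists[of UNIV M] by (auto simp: mats_def)
  then have "is_drazin M (drazin M)"
    unfolding drazin_def is_drazin_def[symmetric] by (metis is_drazin_unique the_equality)
  then show "drazin M ** M = M ** drazin M" "drazin M ** M ** drazin M = drazin M"
    by (auto simp: is_drazin_def)
qed

section \<open>Hermitian forms\<close>

text \<open>Only the real part of the Hermitian form enters the cost, and it is the Euclidean inner product of
  the underlying real space. Working with the latter turns the first variation into real calculus.\<close>

lemma Re_cinner: "Re (cinner x y) = x \<bullet> y"
  by (simp add: cinner_def inner_vec_def inner_complex_def)

lemma cinner_ctranspose: "cinner x (A *v y) = cinner (ctranspose A *v x) y"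
proof -
  have "cinner x (A *v y) = (\<Sum>i\<in>UNIV. \<Sum>j\<in>UNIV. cnj (x $ i) * (A $ i $ j * y $ j))"
    by (simp add: cinner_def matrix_vector_mult_def sum_distrib_left)
  also have "\<dots> = (\<Sum>j\<in>UNIV. \<Sum>i\<in>UNIV. cnj (x $ i) * (A $ i $ j * y $ j))"
    by (rule sum.swap)
  also have "\<dots> = cinner (ctranspose A *v x) y"
    by (simp add: cinner_def ctranspose_def transpose_def matrix_vector_mult_def sum_distrib_left sum_distrib_right mult_ac)
  finally show ?thesis .
qed

lemma inner_ctranspose: "x \<bullet> (A *v y) = (ctranspose A *v x) \<bullet> y"
  by (metis Re_cinner cinner_ctranspose)

lemma ctranspose_mult: "ctranspose (A ** B) = ctranspose B ** ctranspose A"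
  by (simp add: ctranspose_def transpose_def matrix_matrix_mult_def vec_eq_iff mult.commute)

lemma psd_inner: "psd K A \<Longrightarrow> x \<in> vecs K \<Longrightarrow> 0 \<le> x \<bullet> (A *v x)"
  unfolding psd_def by (metis Re_cinner complex_nonneg_Reals_iff)

text \<open>The form is nonnegative at \<open>x - sAx\<close> for every real \<open>s\<close>, which for small \<open>s > 0\<close> would fail by the
  linear term \<open>-2s|Ax|\<^sup>2\<close> if \<open>Ax\<close> were not zero. The test vector lies in \<open>K\<^sup>n\<close>, as it must when positivity is
  known there only.\<close>

lemma psd_kernel:
  assumes K: "K = \<real> \<or> K = UNIV" and A: "A \<in> mats K" "ctranspose A = A" "psd K A"
    and x: "x \<in> vecs K" "x \<bullet> (A *v x) = 0"
  shows "A *v x = 0"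
proof -
  define y where "y = A *v x"
  define c where "c = y \<bullet> y"
  define q where "q = y \<bullet> (A *v y)"
  \<comment> \<open>A step short enough for the quadratic term \<open>s\<^sup>2q\<close> not to compensate the linear term \<open>-2sc\<close>.\<close>
  define s where "s = c / (q + 1)"
  have y: "y \<in> vecs K"
    unfolding y_def by (rule mats_mult_vec[OF K A(1) x(1)])
  have q: "q \<ge> 0"
    unfolding q_def by (rule psd_inner[OF A(3) y])
  have "x - s *\<^sub>R y \<in> vecs K"
    by (intro subspace_diff subspace_scale subspace_vecs[OF K] x y)
  then have "0 \<le> (x - s *\<^sub>R y) \<bullet> (A *v (x - s *\<^sub>R y))"
    by (rule psd_inner[OF A(3)])
  also have "\<dots> = x \<bullet> (A *v x) - s * (x \<bullet> (A *v y)) - s * (y \<bullet> (A *v x)) + s * s * q"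
    by (simp add: q_def algebra_simps inner_diff_left inner_diff_right linear_cmul[OF matrix_vector_mul_linear])
  also have "x \<bullet> (A *v y) = c"
    by (metis inner_ctranspose A(2) y_def c_def)
  also have "y \<bullet> (A *v x) = c"
    by (simp add: y_def c_def)
  also have "x \<bullet> (A *v x) - s * c - s * c + s * s * q = - (c\<^sup>2 * (q + 2) / (q + 1)\<^sup>2)"
  proof -
    have "c / d * (c / d) * (d - 1) - c / d * c - c / d * c = - (c\<^sup>2 * (d + 1) / d\<^sup>2)"
      if "d > 0" for d :: real
      using that by (simp add: field_simps power2_eq_square)
    from this[of "q + 1"] show ?thesis
      using q x(2) by (simp add: s_def add.assoc)
  qed
  finally have "c\<^sup>2 * (q + 2) / (q + 1)\<^sup>2 \<le> 0"
    by simp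
  then have "c = 0"
    using q by (simp add: divide_le_0_iff mult_le_0_iff) 
  then show ?thesis
    by (simp add: c_def y_def)
qed

section \<open>The matrix exponential\<close>

lemma mpow_scaleR: "mpow (t *\<^sub>R A) k = t ^ k *\<^sub>R mpow A k"
  by (induction k) (simp_all add: mpow_Suc linear_cmul[OF linear_matrix_mult_left] linear_cmul[OF linear_matrix_mult_right])

lemma mexp_sums:
  fixes A :: "complex^'n^'n"
  shows "(\<lambda>k. (t ^ k / fact k) *\<^sub>R mpow A k) sums mexp (t *\<^sub>R A)"
proof -
  obtain c where c: "c > 0" "\<And>X :: complex^'n^'n. norm (A ** X) \<le> norm X * c"
    using bounded_linear.pos_bounded[OF bounded_linear_matrix_mult_left[of A]] by blast
  have bound: "norm (mpow A k) \<le> norm (mat 1 :: complex^'n^'n) * c ^ k" for k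
  proof (induction k)
    case (Suc k)
    have "norm (mpow A (Suc k)) \<le> norm (mpow A k) * c"
      by (simp add: mpow_Suc c(2))
    also have "\<dots> \<le> norm (mat 1 :: complex^'n^'n) * c ^ k * c"
      using Suc c(1) by (intro mult_right_mono) auto
    finally show ?case by (simp add: mult_ac)
  qed simp
  have "summable (\<lambda>k. norm (mat 1 :: complex^'n^'n) * ((\<bar>t\<bar> * c) ^ k / fact k))"
    using summable_exp[of "\<bar>t\<bar> * c"] by (intro summable_mult) (simp add: divide_inverse mult.commute)
  then have "summable (\<lambda>k. (t ^ k / fact k) *\<^sub>R mpow A k)"
  proof (rule summable_comparison_test'[where N = 0])
    fix k :: nat
    show "norm ((t ^ k / fact k) *\<^sub>R mpow A k) \<le> norm (mat 1 :: complex^'n^'n) * ((\<bar>t\<bar> * c) ^ k / fact k)"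
      using mult_left_mono[OF bound[of k], of "\<bar>t\<bar> ^ k / fact k"]
      by (simp add: power_abs power_mult_distrib mult_ac)
  qed
  moreover have "(\<lambda>k. (1 / fact k) *\<^sub>R mpow (t *\<^sub>R A) k) = (\<lambda>k. (t ^ k / fact k) *\<^sub>R mpow A k)"
    by (simp add: mpow_scaleR)
  ultimately show ?thesis
    unfolding mexp_def by (simp add: summable_sums)
qed

lemma mexp_0: "mexp (0 :: complex^'n^'n) = mat 1"
proof -
  have "(\<lambda>k. (0 ^ k / fact k) *\<^sub>R mpow (0 :: complex^'n^'n) k) = (\<lambda>k. if k = 0 then mat 1 else 0)"
    by (auto simp: fun_eq_iff)
  then have "(\<lambda>k. (0 ^ k / fact k) *\<^sub>R mpow (0 :: complex^'n^'n) k) sums mat 1"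
    using sums_single[of 0 "\<lambda>_. mat 1 :: complex^'n^'n"] by simp
  then show ?thesis
    using sums_unique2 mexp_sums[of 0 "0 :: complex^'n^'n"] by fastforce
qed

lemma mexp_commute:
  assumes "X ** A = A ** X"
  shows "X ** mexp A = mexp A ** X"
proof -
  have "(\<lambda>k. X ** ((1 ^ k / fact k) *\<^sub>R mpow A k)) sums (X ** mexp A)"
    "(\<lambda>k. ((1 ^ k / fact k) *\<^sub>R mpow A k) ** X) sums (mexp A ** X)"
    using bounded_linear.sums[OF bounded_linear_matrix_mult_left[of X] mexp_sums[of 1 A]]
      bounded_linear.sums[OF bounded_linear_matrix_mult_right[of X] mexp_sums[of 1 A]]
    unfolding scaleR_one .
  moreover have "X ** ((1 ^ k / fact k) *\<^sub>R mpow A k) = ((1 ^ k / fact k) *\<^sub>R mpow A k) ** X" for k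
    using mpow_commute[OF assms]
    by (simp add: linear_cmul[OF linear_matrix_mult_left] linear_cmul[OF linear_matrix_mult_right])
  ultimately show ?thesis
    using sums_unique2 by auto
qed

lemma mexp_mats:
  assumes "K = \<real> \<or> K = UNIV" "A \<in> mats K"
  shows "mexp A \<in> mats K"
proof (rule closed_sequentially[OF closed_subspace[OF subspace_mats[OF assms(1)]]])
  show "(\<lambda>n. \<Sum>k<n. (1 ^ k / fact k) *\<^sub>R mpow A k) \<longlonglongrightarrow> mexp A"
    using mexp_sums[of 1 A] by (simp add: sums_def)
  show "(\<Sum>k<n. (1 ^ k / fact k) *\<^sub>R mpow A k) \<in> mats K" for n
    by (intro subspace_sum subspace_scale subspace_mats mats_mpow assms)
qed

text \<open>Each real coordinate of the exponential is an everywhere convergent real power series, which may be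
  differentiated termwise.\<close>

lemma mexp_has_vector_derivative:
  "((\<lambda>t. mexp (t *\<^sub>R A)) has_vector_derivative A ** mexp (t *\<^sub>R A)) (at t)"
proof -
  have "((\<lambda>t. mexp (t *\<^sub>R A) \<bullet> b) has_real_derivative (A ** mexp (t *\<^sub>R A)) \<bullet> b) (at t)" for b
  proof -
    define c where "c k = (mpow A k \<bullet> b) / fact k" for k
    have s: "(\<lambda>k. c k * t ^ k) sums (mexp (t *\<^sub>R A) \<bullet> b)" for t
      using bounded_linear.sums[OF bounded_linear_inner_left[of b] mexp_sums[of t A]]
      by (simp add: c_def mult_ac)
    have d: "(\<lambda>k. diffs c k * t ^ k) sums ((A ** mexp (t *\<^sub>R A)) \<bullet> b)"
    proof -
      have "diffs c k * t ^ k = (A ** ((t ^ k / fact k) *\<^sub>R mpow A k)) \<bullet> b" for k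
        by (simp add: diffs_def c_def mpow_Suc linear_cmul[OF linear_matrix_mult_left] field_simps del: of_nat_Suc)
      then show ?thesis
        using bounded_linear.sums[OF bounded_linear_inner_left[of b]
            bounded_linear.sums[OF bounded_linear_matrix_mult_left[of A] mexp_sums[of t A]]] by simp
    qed
    have "((\<lambda>t. \<Sum>k. c k * t ^ k) has_real_derivative (\<Sum>k. diffs c k * t ^ k)) (at t)"
      using s by (intro termdiffs_strong_converges_everywhere) (rule sums_summable)
    then show ?thesis
      using sums_unique[OF s] sums_unique[OF d] by simp
  qed
  then have "((\<lambda>t. mexp (t *\<^sub>R A) \<bullet> b) has_derivative (\<lambda>h. (h *\<^sub>R (A ** mexp (t *\<^sub>R A))) \<bullet> b)) (at t)" for b
    unfolding has_field_derivative_def inner_scaleR_left by (simp add: mult_commute_abs)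
  then show ?thesis
    unfolding has_vector_derivative_def by (rule has_derivative_componentwise_within[THEN iffD2, OF ballI])
qed

section \<open>Weak derivatives\<close>

text \<open>Densities that concentrate at \<open>c\<close>. The point may be an end point of the interval: the
  densities used below lie on one side of it.\<close>

lemma approximate_identity:
  fixes F :: "real \<Rightarrow> 'a::euclidean_space" and p :: "nat \<Rightarrow> real \<Rightarrow> real"
  assumes F: "continuous_on {a..b} F" and c: "c \<in> {a..b}"
    and p_int: "\<And>n. (p n has_integral 1) {a..b}"
    and p_cont: "\<And>n. continuous_on {a..b} (p n)"
    and p_nonneg: "\<And>n t. p n t \<ge> 0"
    and p_supp: "\<And>n t. p n t \<noteq> 0 \<Longrightarrow> \<bar>t - c\<bar> \<le> \<delta> n"
    and \<delta>: "\<delta> \<longlonglongrightarrow> 0"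
  shows "(\<lambda>n. integral {a..b} (\<lambda>t. p n t *\<^sub>R F t)) \<longlonglongrightarrow> F c"
proof (rule LIMSEQ_I)
  fix e :: real assume "e > 0"
  then have "e / 2 > 0" by simp
  with F c obtain d where d: "d > 0" "\<And>t. t \<in> {a..b} \<Longrightarrow> dist t c < d \<Longrightarrow> dist (F t) (F c) < e / 2"
    unfolding continuous_on_iff by meson
  from \<delta> d(1) obtain n0 where n0: "\<And>n. n \<ge> n0 \<Longrightarrow> \<bar>\<delta> n\<bar> < d"
    by (metis LIMSEQ_D diff_zero real_norm_def)
  show "\<exists>n0. \<forall>n\<ge>n0. norm (integral {a..b} (\<lambda>t. p n t *\<^sub>R F t) - F c) < e"
  proof (intro exI allI impI)
    fix n assume "n \<ge> n0"
    then have small: "\<bar>\<delta> n\<bar> < d" using n0 by blast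
    have int1: "(\<lambda>t. p n t *\<^sub>R F t) integrable_on {a..b}"
      by (intro integrable_continuous_real continuous_intros F p_cont)
    have const: "((\<lambda>t. p n t *\<^sub>R F c) has_integral F c) {a..b}"
      using has_integral_scaleR_left[OF p_int[of n], of "F c"] by simp
    have "integral {a..b} (\<lambda>t. p n t *\<^sub>R F t) - F c = integral {a..b} (\<lambda>t. p n t *\<^sub>R F t - p n t *\<^sub>R F c)"
      using Henstock_Kurzweil_Integration.integral_diff[OF int1 has_integral_integrable[OF const]]
        integral_unique[OF const] by simp
    also have "norm \<dots> \<le> integral {a..b} (\<lambda>t. p n t * (e / 2))"
    proof (rule integral_norm_bound_integral)
      show "(\<lambda>t. p n t *\<^sub>R F t - p n t *\<^sub>R F c) integrable_on {a..b}"
        by (intro integrable_continuous_real continuous_intros F p_cont)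
      show "(\<lambda>t. p n t * (e / 2)) integrable_on {a..b}"
        by (intro integrable_continuous_real continuous_intros p_cont)
      fix t assume t: "t \<in> {a..b}"
      show "norm (p n t *\<^sub>R F t - p n t *\<^sub>R F c) \<le> p n t * (e / 2)"
      proof (cases "p n t = 0")
        case False
        then have "dist (F t) (F c) < e / 2"
          using p_supp[of n t] small d(2)[OF t] by (auto simp: dist_real_def)
        then show ?thesis
          using p_nonneg[of n t]
          by (metis dist_norm norm_scaleR abs_of_nonneg scaleR_diff_right mult_left_mono less_imp_le)
      qed simp
    qed
    also have "\<dots> = e / 2"
      using integral_unique[OF has_integral_mult_left[OF p_int[of n], of "e / 2"]] by simp
    finally show "norm (integral {a..b} (\<lambda>t. p n t *\<^sub>R F t) - F c) < e"
      using \<open>e > 0\<close> by simp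
  qed
qed

text \<open>A cut-off of class \<open>C\<^sup>1\<close>, equal to 0 left of 0 and to 1 right of 1. Since \<open>s|s|\<close> is a primitive of
  \<open>2|s|\<close>, its second difference is a primitive of a tent function.\<close>

definition smooth_step :: "real \<Rightarrow> real" where
  "smooth_step s = 1 / 2 + s * \<bar>s\<bar> - 2 * ((s - 1/2) * \<bar>s - 1/2\<bar>) + (s - 1) * \<bar>s - 1\<bar>"

definition smooth_step_slope :: "real \<Rightarrow> real" where
  "smooth_step_slope s = 2 * \<bar>s\<bar> - 4 * \<bar>s - 1/2\<bar> + 2 * \<bar>s - 1\<bar>"

lemma DERIV_mult_abs: "((\<lambda>s::real. s * \<bar>s\<bar>) has_real_derivative 2 * \<bar>s\<bar>) (at s)"
proof (cases "s = 0")
  case True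
  have "(\<lambda>h::real. \<bar>h\<bar>) \<midarrow>0\<rightarrow> 0"
    using tendsto_rabs_zero[OF tendsto_ident_at] by fastforce
  then have "(\<lambda>h::real. h * \<bar>h\<bar> / h) \<midarrow>0\<rightarrow> 0"
    by (rule Lim_transform_eventually) (auto simp: eventually_at intro: exI[of _ 1])
  then show ?thesis
    using True by (simp add: DERIV_def)
next
  case False
  then consider "s > 0" | "s < 0" by linarith
  then show ?thesis
  proof cases
    case 1
    have "((\<lambda>s::real. s * s) has_real_derivative 2 * \<bar>s\<bar>) (at s)"
      using 1 by (auto intro!: derivative_eq_intros)
    then show ?thesis
      by (rule has_field_derivative_transform_within_open[of _ _ _ "{0<..}"]) (use 1 in auto)
  next
    case 2
    have "((\<lambda>s::real. - (s * s)) has_real_derivative 2 * \<bar>s\<bar>) (at s)"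
      using 2 by (auto intro!: derivative_eq_intros)
    then show ?thesis
      by (rule has_field_derivative_transform_within_open[of _ _ _ "{..<0}"]) (use 2 in auto)
  qed
qed

lemma smooth_step_deriv: "(smooth_step has_real_derivative smooth_step_slope s) (at s)"
proof -
  have sh: "((\<lambda>s::real. (s - c) * \<bar>s - c\<bar>) has_real_derivative 2 * \<bar>s - c\<bar>) (at s)" for c
    using DERIV_shift[of "\<lambda>s. s * \<bar>s\<bar>" "2 * \<bar>s - c\<bar>" s "-c"] DERIV_mult_abs[of "s - c"] by simp
  show ?thesis
    unfolding smooth_step_def smooth_step_slope_def
    by (rule derivative_eq_intros DERIV_mult_abs sh refl)+ simp
qed

lemma smooth_step_low: "s \<le> 0 \<Longrightarrow> smooth_step s = 0"
  by (simp add: smooth_step_def algebra_simps)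

lemma smooth_step_high: "s \<ge> 1 \<Longrightarrow> smooth_step s = 1"
  by (simp add: smooth_step_def algebra_simps)

lemma smooth_step_slope_nonneg: "smooth_step_slope s \<ge> 0"
  by (simp add: smooth_step_slope_def abs_if)

lemma smooth_step_slope_outside: "smooth_step_slope s \<noteq> 0 \<Longrightarrow> 0 < s \<and> s < 1"
  by (auto simp: smooth_step_slope_def abs_if split: if_splits)

lemma smooth_step_bounds: "0 \<le> smooth_step s \<and> smooth_step s \<le> 1"
proof -
  have mono: "smooth_step s \<le> smooth_step r" if "s \<le> r" for s r
    using that by (rule DERIV_nonneg_imp_nondecreasing) (use smooth_step_deriv smooth_step_slope_nonneg in blast)
  show ?thesis
    using mono[of "min s 0" s] mono[of s "max s 1"] by (simp add: smooth_step_low smooth_step_high)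
qed

lemma continuous_smooth_step_slope [continuous_intros]:
  "continuous_on S f \<Longrightarrow> continuous_on S (\<lambda>x. smooth_step_slope (f x))"
  unfolding smooth_step_slope_def by (intro continuous_intros)

lemma continuous_smooth_step [continuous_intros]:
  "continuous_on S f \<Longrightarrow> continuous_on S (\<lambda>x. smooth_step (f x))"
  unfolding smooth_step_def by (intro continuous_intros)

lemma absolutely_integrable_continuous_scaleR:
  fixes g :: "real \<Rightarrow> 'a::euclidean_space"
  assumes "continuous_on {a..b} f" "g absolutely_integrable_on {a..b}"
  shows "(\<lambda>t. f t *\<^sub>R g t) absolutely_integrable_on {a..b}"
proof (rule absolutely_integrable_bounded_measurable_product[where h = "\<lambda>r x. r *\<^sub>R x"])
  show "bilinear (\<lambda>(r::real) x::'a. r *\<^sub>R x)"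
    using bounded_bilinear_scaleR by (simp add: bilinear_conv_bounded_bilinear)
  show "f \<in> borel_measurable (lebesgue_on {a..b})"
    using assms(1) by (simp add: continuous_imp_measurable_on_sets_lebesgue)
  show "bounded (f ` {a..b})"
    using assms(1) by (simp add: compact_continuous_image compact_imp_bounded)
qed (use assms in auto)

text \<open>The test functions \<open>\<phi>\<^sub>nl\<close>, where \<open>\<phi>\<^sub>n\<close> is a cut-off that rises to 1 near \<open>a\<close> and falls to 0
  near \<open>b\<close>, give \<open>\<integral>\<phi>\<^sub>n(l'x + lg) = -\<integral>\<phi>\<^sub>n'lx\<close>. On the left, dominated convergence removes \<open>\<phi>\<^sub>n\<close>; on the right, the
  two bumps of \<open>\<phi>\<^sub>n'\<close> converge to evaluations at \<open>a\<close> and \<open>b\<close>. With \<open>l = 1\<close> this is the fundamental theorem of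
  calculus for \<open>W\<^sup>1\<^sup>,\<^sup>1\<close> functions.\<close>

lemma weak_derivative_by_parts:
  fixes x g :: "real \<Rightarrow> 'a::euclidean_space" and l l' :: "real \<Rightarrow> real"
  assumes ab: "a < b" and x: "continuous_on {a..b} x"
    and g: "g absolutely_integrable_on {a..b}" and weak: "has_weak_derivative x g a b"
    and l: "\<And>t. (l has_real_derivative l' t) (at t)" and l': "continuous_on UNIV l'"
  shows "((\<lambda>t. l' t *\<^sub>R x t + l t *\<^sub>R g t) has_integral l b *\<^sub>R x b - l a *\<^sub>R x a) {a..b}"
proof -
  have l_cont: "continuous_on S l" for S
    by (rule continuous_at_imp_continuous_on) (auto intro: DERIV_isCont[OF l])
  have l'_cont: "continuous_on S l'" for S
    using l' continuous_on_subset by blast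
  \<comment> \<open>The cut-off rises on \<open>[a + \<epsilon>, a + 2\<epsilon>]\<close> and falls on \<open>[b - 2\<epsilon>, b - \<epsilon>]\<close>; for these to be disjoint \<open>4\<epsilon> \<le> b - a\<close> is needed.\<close>
  define \<epsilon> where "\<epsilon> n = (b - a) / 4 * inverse (real (Suc n))" for n
  have \<epsilon>0: "\<epsilon> n > 0" for n
    using ab by (simp add: \<epsilon>_def)
  have \<epsilon>4: "4 * \<epsilon> n \<le> b - a" for n
    using ab mult_left_mono[of "inverse (real (Suc n))" 1 "b - a"] by (simp add: \<epsilon>_def field_simps)
  have \<epsilon>_lim: "\<epsilon> \<longlonglongrightarrow> 0"
    unfolding \<epsilon>_def by (intro tendsto_mult_right_zero LIMSEQ_inverse_real_of_nat)
  define up where "up n t = smooth_step ((t - a) / \<epsilon> n - 1)" for n t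
  define down where "down n t = smooth_step ((t - b) / \<epsilon> n + 2)" for n t
  define up' where "up' n t = smooth_step_slope ((t - a) / \<epsilon> n - 1) / \<epsilon> n" for n t
  define down' where "down' n t = smooth_step_slope ((t - b) / \<epsilon> n + 2) / \<epsilon> n" for n t
  have dup: "(up n has_real_derivative up' n t) (at t)" for n t
  proof -
    have "((\<lambda>t. (t - a) / \<epsilon> n - 1) has_real_derivative 1 / \<epsilon> n) (at t)"
      using \<epsilon>0[of n] by (auto intro!: derivative_eq_intros)
    from DERIV_chain2[OF smooth_step_deriv this] show ?thesis
      unfolding up_def up'_def by simp
  qed
  have ddown: "(down n has_real_derivative down' n t) (at t)" for n t
  proof -
    have "((\<lambda>t. (t - b) / \<epsilon> n + 2) has_real_derivative 1 / \<epsilon> n) (at t)"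
      using \<epsilon>0[of n] by (auto intro!: derivative_eq_intros)
    from DERIV_chain2[OF smooth_step_deriv this] show ?thesis
      unfolding down_def down'_def by simp
  qed
  have cont: "continuous_on S (up n)" "continuous_on S (up' n)"
     "continuous_on S (down n)" "continuous_on S (down' n)" for n S
    unfolding up_def up'_def down_def down'_def using \<epsilon>0[of n] 
    by (auto intro!: continuous_intros)
  have low: "up n t = 0" "down n t = 0" if "t \<le> a + \<epsilon> n" for n t
  proof -
    have "(t - a) / \<epsilon> n - 1 \<le> 0" "(t - b) / \<epsilon> n + 2 \<le> 0"
      using that \<epsilon>0[of n] \<epsilon>4[of n] by (auto simp: field_simps)
    then show "up n t = 0" "down n t = 0"
      by (auto simp: up_def down_def smooth_step_low)
  qed
  have high: "up n t = 1" "down n t = 1" if "t \<ge> b - \<epsilon> n" for n t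
  proof -
    have "(t - a) / \<epsilon> n - 1 \<ge> 1" "(t - b) / \<epsilon> n + 2 \<ge> 1"
      using that \<epsilon>0[of n] \<epsilon>4[of n] by (auto simp: field_simps)
    then show "up n t = 1" "down n t = 1"
      by (auto simp: up_def down_def smooth_step_high)
  qed
  have mid: "up n t - down n t = 1" if "a + 2 * \<epsilon> n \<le> t" "t \<le> b - 2 * \<epsilon> n" for n t
  proof -
    have "(t - a) / \<epsilon> n - 1 \<ge> 1" "(t - b) / \<epsilon> n + 2 \<le> 0"
      using that \<epsilon>0[of n] \<epsilon>4[of n] by (auto simp: field_simps)
    then show ?thesis
      by (auto simp: up_def down_def smooth_step_low smooth_step_high)
  qed
  have lim_up: "(\<lambda>n. integral {a..b} (\<lambda>t. up' n t *\<^sub>R (l t *\<^sub>R x t))) \<longlonglongrightarrow> l a *\<^sub>R x a"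
  proof (rule approximate_identity[where \<delta> = "\<lambda>n. 2 * \<epsilon> n"])
    fix n
    have "(up' n has_integral up n b - up n a) {a..b}"
      using ab dup by (intro fundamental_theorem_of_calculus)
        (auto simp: has_real_derivative_iff_has_vector_derivative[symmetric] intro: has_field_derivative_at_within)
    then show "(up' n has_integral 1) {a..b}"
      using low[of a n] high[of n b] \<epsilon>0[of n] by simp
    fix t assume "up' n t \<noteq> 0"
    then have "0 < (t - a) / \<epsilon> n - 1 \<and> (t - a) / \<epsilon> n - 1 < 1"
      using smooth_step_slope_outside[of "(t - a) / \<epsilon> n - 1"] by (simp add: up'_def)
    then show "\<bar>t - a\<bar> \<le> 2 * \<epsilon> n"
      using \<epsilon>0[of n] by (auto simp: field_simps)
  next
    show "(\<lambda>n. 2 * \<epsilon> n) \<longlonglongrightarrow> 0"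
      using tendsto_mult_right_zero[OF \<epsilon>_lim] by simp
    show "continuous_on {a..b} (\<lambda>t. l t *\<^sub>R x t)"
      by (intro continuous_intros x l_cont)
  qed (use ab cont in \<open>auto simp: up'_def smooth_step_slope_nonneg \<epsilon>0 less_imp_le\<close>)
  have lim_down: "(\<lambda>n. integral {a..b} (\<lambda>t. down' n t *\<^sub>R (l t *\<^sub>R x t))) \<longlonglongrightarrow> l b *\<^sub>R x b"
  proof (rule approximate_identity[where \<delta> = "\<lambda>n. 2 * \<epsilon> n"])
    fix n
    have "(down' n has_integral down n b - down n a) {a..b}"
      using ab ddown by (intro fundamental_theorem_of_calculus)
        (auto simp: has_real_derivative_iff_has_vector_derivative[symmetric] intro: has_field_derivative_at_within)
    then show "(down' n has_integral 1) {a..b}"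
      using low[of a n] high[of n b] \<epsilon>0[of n] by simp
    fix t assume "down' n t \<noteq> 0"
    then have "0 < (t - b) / \<epsilon> n + 2 \<and> (t - b) / \<epsilon> n + 2 < 1"
      using smooth_step_slope_outside[of "(t - b) / \<epsilon> n + 2"] by (simp add: down'_def)
    then show "\<bar>t - b\<bar> \<le> 2 * \<epsilon> n"
      using \<epsilon>0[of n] by (auto simp: field_simps)
  next
    show "(\<lambda>n. 2 * \<epsilon> n) \<longlonglongrightarrow> 0"
      using tendsto_mult_right_zero[OF \<epsilon>_lim] by simp
    show "continuous_on {a..b} (\<lambda>t. l t *\<^sub>R x t)"
      by (intro continuous_intros x l_cont)
  qed (use ab cont in \<open>auto simp: down'_def smooth_step_slope_nonneg \<epsilon>0 less_imp_le\<close>)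
  \<comment> \<open>The integrand in the limit; open intervals below, since the cut-offs are 0 at the end points.\<close>
  define h where "h t = l' t *\<^sub>R x t + l t *\<^sub>R g t" for t
  have h1: "(\<lambda>t. l' t *\<^sub>R x t) absolutely_integrable_on {a..b}"
    by (intro absolutely_integrable_continuous_real continuous_intros x l'_cont)
  have h2: "(\<lambda>t. l t *\<^sub>R g t) absolutely_integrable_on {a..b}"
    by (intro absolutely_integrable_continuous_scaleR g l_cont)
  have h_int: "h absolutely_integrable_on {a..b}"
    unfolding h_def by (intro set_integral_add h1 h2)
  let ?\<phi> = "\<lambda>n t. up n t - down n t"
  have \<phi>h: "(\<lambda>t. ?\<phi> n t *\<^sub>R f t) integrable_on {a..b}"
    if "f absolutely_integrable_on {a..b}" for n and f :: "real \<Rightarrow> 'a"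
    by (rule set_lebesgue_integral_eq_integral(1)[OF absolutely_integrable_continuous_scaleR[OF _ that]])
      (intro continuous_intros cont)
  have lim_h: "(\<lambda>n. integral {a<..<b} (\<lambda>t. ?\<phi> n t *\<^sub>R h t)) \<longlonglongrightarrow> integral {a<..<b} h"
  proof (rule dominated_convergence(2)[where h = "\<lambda>t. norm (h t)"])
    show "(\<lambda>t. ?\<phi> n t *\<^sub>R h t) integrable_on {a<..<b}" for n
      using \<phi>h[OF h_int] integrable_on_open_interval_real by blast
    show "(\<lambda>t. norm (h t)) integrable_on {a<..<b}"
      using h_int integrable_on_open_interval_real absolutely_integrable_on_def by blast
    show "norm (?\<phi> n t *\<^sub>R h t) \<le> norm (h t)" for n t
    proof -
      have "\<bar>?\<phi> n t\<bar> \<le> 1"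
        using smooth_step_bounds[of "(t - a) / \<epsilon> n - 1"] smooth_step_bounds[of "(t - b) / \<epsilon> n + 2"]
        by (auto simp: up_def down_def)
      then show ?thesis by (simp add: mult_left_le_one_le)
    qed
    fix t assume t: "t \<in> {a<..<b}"
    have "(\<lambda>n. 2 * \<epsilon> n) \<longlonglongrightarrow> 0"
      using tendsto_mult_right_zero[OF \<epsilon>_lim] by simp
    from order_tendstoD(2)[OF this, of "min (t - a) (b - t)"] t
    have "\<forall>\<^sub>F n in sequentially. 2 * \<epsilon> n < min (t - a) (b - t)"
      by simp
    then have "\<forall>\<^sub>F n in sequentially. ?\<phi> n t *\<^sub>R h t = h t"
    proof eventually_elim
      case (elim n)
      then show ?case using mid[of n t] by simp
    qed
    then show "(\<lambda>n. ?\<phi> n t *\<^sub>R h t) \<longlonglongrightarrow> h t"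
      by (rule tendsto_eventually)
  qed
  have id: "integral {a..b} (\<lambda>t. ?\<phi> n t *\<^sub>R h t) =
      integral {a..b} (\<lambda>t. down' n t *\<^sub>R (l t *\<^sub>R x t)) - integral {a..b} (\<lambda>t. up' n t *\<^sub>R (l t *\<^sub>R x t))" for n
  proof -
    let ?f = "\<lambda>t. ?\<phi> n t * l t" and ?f' = "\<lambda>t. (up' n t - down' n t) * l t + ?\<phi> n t * l' t"
    have df: "(?f has_real_derivative ?f' t) (at t)" for t
      by (rule derivative_eq_intros dup ddown l refl)+ simp
    have "?f C1_differentiable_on UNIV"
      unfolding C1_differentiable_on_def
      using df by (intro exI[of _ ?f']) (auto simp: has_real_derivative_iff_has_vector_derivative[symmetric]
          intro!: continuous_intros cont l_cont l'_cont)
    moreover have "closure {t. ?f t \<noteq> 0} \<subseteq> {a + \<epsilon> n..b - \<epsilon> n}"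
    proof (rule closure_minimal)
      show "{t. ?f t \<noteq> 0} \<subseteq> {a + \<epsilon> n..b - \<epsilon> n}"
        using low[of _ n] high[of n] by (auto simp: not_le) (metis less_eq_real_def not_less diff_self)+
    qed simp
    then have "closure {t. ?f t \<noteq> 0} \<subseteq> {a<..<b}"
      using \<epsilon>0[of n] by force
    ultimately have w: "integral {a..b} (\<lambda>t. deriv ?f t *\<^sub>R x t) = - integral {a..b} (\<lambda>t. ?f t *\<^sub>R g t)"
      using weak unfolding has_weak_derivative_def by blast
    have dd: "deriv ?f t = ?f' t" for t
      using df by (rule DERIV_imp_deriv)
    have i1: "(\<lambda>t. ?f t *\<^sub>R g t) integrable_on {a..b}"
      using \<phi>h[OF h2, of n] by simp
    have i2: "(\<lambda>t. ?f' t *\<^sub>R x t) integrable_on {a..b}"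
      "(\<lambda>t. up' n t *\<^sub>R (l t *\<^sub>R x t)) integrable_on {a..b}"
      "(\<lambda>t. down' n t *\<^sub>R (l t *\<^sub>R x t)) integrable_on {a..b}"
      by (intro integrable_continuous_real continuous_intros cont l_cont l'_cont x)+
    have "integral {a..b} (\<lambda>t. ?\<phi> n t *\<^sub>R h t) =
      integral {a..b} (\<lambda>t. (?f' t *\<^sub>R x t + ?f t *\<^sub>R g t) + (down' n t *\<^sub>R (l t *\<^sub>R x t) - up' n t *\<^sub>R (l t *\<^sub>R x t)))"
      by (rule integral_cong) (simp add: h_def algebra_simps)
    also have "\<dots> = (integral {a..b} (\<lambda>t. ?f' t *\<^sub>R x t) + integral {a..b} (\<lambda>t. ?f t *\<^sub>R g t)) +
       (integral {a..b} (\<lambda>t. down' n t *\<^sub>R (l t *\<^sub>R x t)) - integral {a..b} (\<lambda>t. up' n t *\<^sub>R (l t *\<^sub>R x t)))"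
      using i1 i2 by (simp only: Henstock_Kurzweil_Integration.integral_add Henstock_Kurzweil_Integration.integral_diff
         Henstock_Kurzweil_Integration.integrable_add Henstock_Kurzweil_Integration.integrable_diff)
    finally show ?thesis using w by (simp add: dd)
  qed
  have "integral {a..b} h = l b *\<^sub>R x b - l a *\<^sub>R x a"
    using lim_h LIMSEQ_unique tendsto_diff[OF lim_down lim_up] 
    unfolding integral_open_interval_real[symmetric] id by blast
  moreover have "h integrable_on {a..b}"
    using h_int by (rule set_lebesgue_integral_eq_integral(1))
  ultimately show ?thesis
    unfolding h_def by (simp add: has_integral_iff)
qed

lemma C1_deriv:
  fixes \<phi> :: "real \<Rightarrow> real"
  assumes "\<phi> C1_differentiable_on UNIV"
  shows "(\<phi> has_real_derivative deriv \<phi> t) (at t)" "continuous_on S (deriv \<phi>)" "continuous_on S \<phi>"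
proof -
  obtain D where D: "\<And>t. (\<phi> has_vector_derivative D t) (at t)" "continuous_on UNIV D"
    using assms unfolding C1_differentiable_on_def by auto
  then have D': "(\<phi> has_real_derivative D t) (at t)" for t
    by (simp add: has_real_derivative_iff_has_vector_derivative)
  then have "deriv \<phi> = D"
    by (intro ext DERIV_imp_deriv)
  then show "(\<phi> has_real_derivative deriv \<phi> t) (at t)" "continuous_on S (deriv \<phi>)"
    using D' continuous_on_subset[OF D(2), of S] by auto
  show "continuous_on S \<phi>"
    by (rule continuous_at_imp_continuous_on) (auto intro: DERIV_isCont[OF D'])
qed

lemma vanishes_outside_support:
  fixes \<phi> :: "real \<Rightarrow> real"
  assumes "closure {t. \<phi> t \<noteq> 0} \<subseteq> {a<..<b}" "t \<notin> {a<..<b}"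
  shows "\<phi> t = 0" "deriv \<phi> t = 0"
proof -
  have t: "t \<in> - closure {t. \<phi> t \<noteq> 0}"
    using assms by blast
  then show "\<phi> t = 0"
    using subsetD[OF closure_subset[of "{t. \<phi> t \<noteq> 0}"], of t] by auto
  have "((\<lambda>_. 0) has_real_derivative 0) (at t)"
    by simp
  then have "(\<phi> has_real_derivative 0) (at t)"
    by (rule has_field_derivative_transform_within_open[of _ _ _ "- closure {t. \<phi> t \<noteq> 0}"])
      (use t closure_subset[of "{t. \<phi> t \<noteq> 0}"] in auto)
  then show "deriv \<phi> t = 0"
    by (rule DERIV_imp_deriv)
qed

lemma has_weak_derivative_restrict:
  assumes weak: "has_weak_derivative x g a b" and c: "c \<le> b"
  shows "has_weak_derivative x g a c"
  unfolding has_weak_derivative_def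
proof (intro allI impI)
  fix \<phi> :: "real \<Rightarrow> real"
  assume \<phi>: "\<phi> C1_differentiable_on UNIV" "closure {t. \<phi> t \<noteq> 0} \<subseteq> {a<..<c}"
  have cut: "integral {a..c} (\<lambda>t. f t *\<^sub>R y t) = integral {a..b} (\<lambda>t. f t *\<^sub>R y t)"
    if "\<And>t. t \<notin> {a<..<c} \<Longrightarrow> f t = 0" for f :: "real \<Rightarrow> real" and y :: "real \<Rightarrow> 'a"
  proof -
    have "{t \<in> {a..c} - {a..b}. f t *\<^sub>R y t \<noteq> 0} = {}" "{t \<in> {a..b} - {a..c}. f t *\<^sub>R y t \<noteq> 0} = {}"
      using c that by auto
    then show ?thesis
      by (intro integral_spike_set) (simp_all only: negligible_empty)
  qed
  have "{a<..<c} \<subseteq> {a<..<b}" using c by auto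
  then have "integral {a..b} (\<lambda>t. deriv \<phi> t *\<^sub>R x t) = - integral {a..b} (\<lambda>t. \<phi> t *\<^sub>R g t)"
    using weak \<phi> unfolding has_weak_derivative_def by blast
  then show "integral {a..c} (\<lambda>t. deriv \<phi> t *\<^sub>R x t) = - integral {a..c} (\<lambda>t. \<phi> t *\<^sub>R g t)"
    using cut[of "deriv \<phi>" x] cut[of \<phi> g] vanishes_outside_support[OF \<phi>(2)] by simp
qed

lemma has_weak_derivative_diff:
  fixes x y g h :: "real \<Rightarrow> 'a::euclidean_space"
  assumes "continuous_on {a..b} x" "g absolutely_integrable_on {a..b}" "has_weak_derivative x g a b"
    and "continuous_on {a..b} y" "h absolutely_integrable_on {a..b}" "has_weak_derivative y h a b"
  shows "has_weak_derivative (\<lambda>t. x t - y t) (\<lambda>t. g t - h t) a b"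
  unfolding has_weak_derivative_def
proof (intro allI impI)
  fix \<phi> :: "real \<Rightarrow> real"
  assume \<phi>: "\<phi> C1_differentiable_on UNIV" "closure {t. \<phi> t \<noteq> 0} \<subseteq> {a<..<b}"
  have i1: "(\<lambda>t. deriv \<phi> t *\<^sub>R z t) integrable_on {a..b}" if "continuous_on {a..b} z" for z :: "real \<Rightarrow> 'a"
    by (intro integrable_continuous_real continuous_intros C1_deriv(2)[OF \<phi>(1)] that)
  have i2: "(\<lambda>t. \<phi> t *\<^sub>R z t) integrable_on {a..b}" if "z absolutely_integrable_on {a..b}" for z :: "real \<Rightarrow> 'a"
    by (rule set_lebesgue_integral_eq_integral(1)[OF absolutely_integrable_continuous_scaleR[OF C1_deriv(3)[OF \<phi>(1)] that]])
  show "integral {a..b} (\<lambda>t. deriv \<phi> t *\<^sub>R (x t - y t)) = - integral {a..b} (\<lambda>t. \<phi> t *\<^sub>R (g t - h t))"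
    using assms \<phi> unfolding has_weak_derivative_def
    by (simp add: scaleR_diff_right Henstock_Kurzweil_Integration.integral_diff i1 i2)
qed

text \<open>Classical integration by parts, in which the boundary terms vanish with the test function.\<close>

lemma has_weak_derivative_C1:
  fixes x x' :: "real \<Rightarrow> 'a::euclidean_space"
  assumes x: "\<And>t. (x has_vector_derivative x' t) (at t)" and x': "continuous_on {a..b} x'"
    and ab: "a \<le> b"
  shows "has_weak_derivative x x' a b"
  unfolding has_weak_derivative_def
proof (intro allI impI)
  fix \<phi> :: "real \<Rightarrow> real"
  assume \<phi>: "\<phi> C1_differentiable_on UNIV" "closure {t. \<phi> t \<noteq> 0} \<subseteq> {a<..<b}"
  have x_cont: "continuous_on {a..b} x"
    using x by (intro continuous_at_imp_continuous_on ballI) (rule has_vector_derivative_continuous)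
  have "((\<lambda>t. \<phi> t *\<^sub>R x' t + deriv \<phi> t *\<^sub>R x t) has_integral \<phi> b *\<^sub>R x b - \<phi> a *\<^sub>R x a) {a..b}"
  proof (rule fundamental_theorem_of_calculus[OF ab])
    fix t
    have "((\<lambda>t. \<phi> t *\<^sub>R x t) has_vector_derivative \<phi> t *\<^sub>R x' t + deriv \<phi> t *\<^sub>R x t) (at t)"
      by (rule has_vector_derivative_scaleR[OF C1_deriv(1)[OF \<phi>(1)] x])
    then show "((\<lambda>t. \<phi> t *\<^sub>R x t) has_vector_derivative \<phi> t *\<^sub>R x' t + deriv \<phi> t *\<^sub>R x t) (at t within {a..b})"
      by (rule has_vector_derivative_at_within)
  qed
  then have "integral {a..b} (\<lambda>t. \<phi> t *\<^sub>R x' t + deriv \<phi> t *\<^sub>R x t) = 0"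
    using vanishes_outside_support(1)[OF \<phi>(2)] by (simp add: integral_unique)
  moreover have "(\<lambda>t. \<phi> t *\<^sub>R x' t) integrable_on {a..b}" "(\<lambda>t. deriv \<phi> t *\<^sub>R x t) integrable_on {a..b}"
    by (intro integrable_continuous_real continuous_intros C1_deriv[OF \<phi>(1)] x_cont x')+
  ultimately show "integral {a..b} (\<lambda>t. deriv \<phi> t *\<^sub>R x t) = - integral {a..b} (\<lambda>t. \<phi> t *\<^sub>R x' t)"
    by (simp add: Henstock_Kurzweil_Integration.integral_add eq_neg_iff_add_eq_0 add.commute)
qed

lemma weak_derivative_integral:
  fixes x g :: "real \<Rightarrow> 'a::euclidean_space"
  assumes x: "continuous_on {a..b} x" and g: "g absolutely_integrable_on {a..b}"
    and weak: "has_weak_derivative x g a b" and t: "t \<in> {a..b}"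
  shows "x t = x a + integral {a..t} g"
proof (cases "a < t")
  case True
  have "((\<lambda>s. 0 *\<^sub>R x s + 1 *\<^sub>R g s) has_integral 1 *\<^sub>R x t - 1 *\<^sub>R x a) {a..t}"
  proof (rule weak_derivative_by_parts[OF True])
    show "continuous_on {a..t} x"
      using x t by (auto elim: continuous_on_subset)
    show "g absolutely_integrable_on {a..t}"
      by (rule absolutely_integrable_on_subinterval[OF g]) (use t in auto)
    show "has_weak_derivative x g a t"
      by (rule has_weak_derivative_restrict[OF weak]) (use t in auto)
  qed auto
  then show ?thesis
    by (simp add: integral_unique)
qed (use t in auto)

text \<open>The scalar rule summed over an orthonormal basis.\<close>

lemma weak_derivative_inner_by_parts:
  fixes x g l l' :: "real \<Rightarrow> 'a::euclidean_space"
  assumes ab: "a < b" and x: "continuous_on {a..b} x"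
    and g: "g absolutely_integrable_on {a..b}" and weak: "has_weak_derivative x g a b"
    and l: "\<And>t. (l has_vector_derivative l' t) (at t)" and l': "continuous_on UNIV l'"
  shows "((\<lambda>t. x t \<bullet> l' t + g t \<bullet> l t) has_integral x b \<bullet> l b - x a \<bullet> l a) {a..b}"
proof -
  have "((\<lambda>t. (x t \<bullet> e) * (l' t \<bullet> e) + (g t \<bullet> e) * (l t \<bullet> e)) has_integral
      (x b \<bullet> e) * (l b \<bullet> e) - (x a \<bullet> e) * (l a \<bullet> e)) {a..b}" for e
  proof -
    have "((\<lambda>t. (l' t \<bullet> e) *\<^sub>R x t + (l t \<bullet> e) *\<^sub>R g t) has_integral (l b \<bullet> e) *\<^sub>R x b - (l a \<bullet> e) *\<^sub>R x a) {a..b}"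
    proof (rule weak_derivative_by_parts[OF ab x g weak])
      show "((\<lambda>t. l t \<bullet> e) has_real_derivative l' t \<bullet> e) (at t)" for t
        using bounded_linear.has_vector_derivative[OF bounded_linear_inner_left l]
        by (simp add: has_real_derivative_iff_has_vector_derivative)
    qed (intro continuous_intros l')
    from has_integral_linear[OF this bounded_linear_inner_left[of e]] show ?thesis
      by (simp add: o_def inner_add_left inner_diff_left mult.commute)
  qed
  then have "((\<lambda>t. \<Sum>e\<in>Basis. (x t \<bullet> e) * (l' t \<bullet> e) + (g t \<bullet> e) * (l t \<bullet> e)) has_integral
      (\<Sum>e\<in>Basis. (x b \<bullet> e) * (l b \<bullet> e) - (x a \<bullet> e) * (l a \<bullet> e))) {a..b}"
    by (intro has_integral_sum) auto
  then show ?thesis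
    by (simp add: sum.distrib sum_subtractf euclidean_inner[symmetric])
qed

lemma AE_lebesgue_on_negligible:
  fixes a b :: real
  assumes "AE t in lebesgue_on {a..b}. P t"
  obtains Z where "negligible Z" "\<And>t. t \<in> {a..b} - Z \<Longrightarrow> P t"
proof -
  have "AE t in lebesgue. t \<in> {a..b} \<longrightarrow> P t"
    using assms using lmeasurable_cbox[of a b]
    by (subst (asm) AE_restrict_space_iff) (simp_all add: fmeasurableD)
  then show ?thesis
    using that by (auto simp: eventually_ae_filter negligible_iff_null_sets)
qed

text \<open>By Lebesgue differentiation \<open>g\<close> is almost everywhere the limit of its means over \<open>[t, t + h]\<close>, and
  these are zero.\<close>

lemma AE_zero_of_integral_zero:
  fixes g :: "real \<Rightarrow> 'a::euclidean_space"
  assumes g: "g integrable_on {a..b}" and zero: "\<And>t. t \<in> {a..b} \<Longrightarrow> integral {a..t} g = 0"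
  shows "AE t in lebesgue_on {a..b}. g t = 0"
proof -
  define f where "f t = (if t \<in> {a..b} then g t else 0)" for t
  have "f integrable_on UNIV"
    unfolding f_def by (rule Henstock_Kurzweil_Integration.integrable_restrict_UNIV[THEN iffD2, OF g])
  then have "f integrable_on cbox c d" for c d
    by (rule integrable_on_subcbox) simp
  then obtain N where N: "negligible N"
    "\<And>t e. t \<notin> N \<Longrightarrow> 0 < e \<Longrightarrow> \<exists>d>0. \<forall>h. 0 < h \<and> h < d \<longrightarrow>
        norm (integral (cbox t (t + h *\<^sub>R One)) f /\<^sub>R h ^ DIM(real) - f t) < e"
    by (rule integrable_ccontinuous_explicit) (rule that)
  have g0: "g t = 0" if t: "t \<in> {a..b}" "t \<notin> insert b N" for t
  proof (rule ccontr)
    assume "g t \<noteq> 0"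
    then have "norm (g t) > 0" by simp
    from N(2)[OF _ this, of t] t obtain d where d: "d > 0" "\<And>h. 0 < h \<Longrightarrow> h < d \<Longrightarrow>
        norm (integral {t..t + h} f /\<^sub>R h - f t) < norm (g t)"
      by auto
    define h where "h = min (d / 2) (b - t)"
    have h: "0 < h" "h < d" "t + h \<le> b"
      using d(1) t by (auto simp: h_def)
    have "integral {t..t + h} f = integral {t..t + h} g"
      using t h by (intro integral_cong) (auto simp: f_def)
    moreover have "integral {a..t} g + integral {t..t + h} g = integral {a..t + h} g"
      using t h by (intro Henstock_Kurzweil_Integration.integral_combine integrable_on_subinterval[OF g]) auto
    ultimately have "integral {t..t + h} f = 0"
      using zero[of t] zero[of "t + h"] t h by simp
    then show False
      using d(2)[OF h(1,2)] t by (simp add: f_def)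
  qed
  have "negligible (insert b N)"
    using N(1) by simp
  then have "AE t in lebesgue. t \<notin> insert b N"
    unfolding negligible_iff_null_sets by (rule AE_not_in)
  then have "AE t in lebesgue. t \<in> {a..b} \<longrightarrow> g t = 0"
    by eventually_elim (use g0 in blast)
  then show ?thesis
    using lmeasurable_cbox[of a b] by (subst AE_restrict_space_iff) (simp_all add: fmeasurableD)
qed

section \<open>Homogeneous linear differential-algebraic equations\<close>

text \<open>If \<open>|Lx| \<le> c|x|\<close>, then \<open>exp(-2ct)|f(t)|\<^sup>2\<close> has a nonpositive derivative, starts at zero and
  is nonnegative.\<close>

lemma linear_ode_zero:
  fixes f :: "real \<Rightarrow> 'a::euclidean_space"
  assumes L: "bounded_linear L"
    and f: "\<And>t. t \<in> {a..b} \<Longrightarrow> (f has_vector_derivative L (f t)) (at t within {a..b})"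
    and f0: "f a = 0" and s: "s \<in> {a..b}"
  shows "f s = 0"
proof (cases "a < s")
  case True
  obtain c where c: "c > 0" "\<And>x. norm (L x) \<le> norm x * c"
    using bounded_linear.pos_bounded[OF L] by blast
  let ?h = "\<lambda>t. exp (- 2 * c * t) * (f t \<bullet> f t)"
  let ?h' = "\<lambda>t. exp (- 2 * c * t) * (2 * (f t \<bullet> L (f t)) - 2 * c * (f t \<bullet> f t))"
  have h: "(?h has_real_derivative ?h' t) (at t within {a..s})" if t: "t \<in> {a..s}" for t
  proof -
    have "(f has_vector_derivative L (f t)) (at t within {a..s})"
      by (rule has_vector_derivative_within_subset[OF f]) (use t s in auto)
    then have "((\<lambda>t. f t \<bullet> f t) has_vector_derivative (f t \<bullet> L (f t) + L (f t) \<bullet> f t)) (at t within {a..s})"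
      by (intro bounded_bilinear.has_vector_derivative[OF bounded_bilinear_inner])
    then have "((\<lambda>t. f t \<bullet> f t) has_real_derivative 2 * (f t \<bullet> L (f t))) (at t within {a..s})"
      by (simp add: has_real_derivative_iff_has_vector_derivative inner_commute)
    then show ?thesis
      by (auto intro!: derivative_eq_intros simp: algebra_simps)
  qed
  obtain r where r: "r \<in> {a<..<s}" "?h s - ?h a = ?h' r * (s - a)"
    using mvt_simple[OF True, of ?h "\<lambda>t x. ?h' t * x"] h unfolding has_field_derivative_def by auto
  have "f r \<bullet> L (f r) \<le> norm (f r) * norm (L (f r))"
    by (rule norm_cauchy_schwarz)
  also have "\<dots> \<le> norm (f r) * (norm (f r) * c)"
    using c(2) by (intro mult_left_mono) auto
  also have "\<dots> = c * (f r \<bullet> f r)"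
    by (simp add: dot_square_norm power2_eq_square)
  finally have "?h' r \<le> 0"
    by (simp add: mult_le_0_iff)
  then have "?h s \<le> 0"
    using r True f0 mult_nonpos_nonneg[of "?h' r" "s - a"] by simp
  then have "f s \<bullet> f s \<le> 0"
    by (simp add: mult_le_0_iff)
  then show ?thesis
    by (metis inner_ge_zero inner_eq_zero_iff antisym)
qed (use f0 s in auto)

text \<open>The equation says \<open>Nz' = \<mu>Nz - z\<close>. Multiplied by \<open>N\<^sup>j\<close>, it shows that \<open>Y\<^sub>j = N\<^sup>jz\<close> satisfies
  \<open>Y\<^sub>j\<^sub>+\<^sub>1' = \<mu>Y\<^sub>j\<^sub>+\<^sub>1 - Y\<^sub>j\<close>, and this holds everywhere, because the right side is continuous although
  \<open>z'\<close> is merely integrable. Choose \<open>k\<close> and \<open>C\<close> with \<open>N\<^sup>k = N\<^sup>k\<^sup>+\<^sup>1C\<close>. Then \<open>Y\<^sub>k = CY\<^sub>k\<^sub>+\<^sub>1\<close> solves the ordinary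
  differential equation \<open>Y\<^sub>k' = (\<mu> - C)Y\<^sub>k\<close>, so \<open>Y\<^sub>k = 0\<close>; and if \<open>Y\<^sub>j\<^sub>+\<^sub>1 = 0\<close>, its equation
  gives \<open>Y\<^sub>j = 0\<close>.\<close>

lemma homogeneous_dae_zero:
  fixes N :: "complex^'k^'k" and z dz :: "real \<Rightarrow> complex^'k"
  assumes ab: "a < b" and z_cont: "continuous_on {a..b} z"
    and dz: "dz integrable_on {a..b}"
    and z: "\<And>t. t \<in> {a..b} \<Longrightarrow> z t = integral {a..t} dz"
    and dae: "AE t in lebesgue_on {a..b}. z t = - (N *v (dz t - mat \<mu> *v z t))"
    and s: "s \<in> {a..b}"
  shows "z s = 0"
proof -
  define Y where "Y j t = mpow N j *v z t" for j t
  have Y_cont: "continuous_on {a..b} (Y j)" for j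
    unfolding Y_def by (intro bounded_linear.continuous_on[OF matrix_vector_mul_bounded_linear] z_cont)
  have Suc_step: "mpow N (Suc j) *v v = mpow N j *v (N *v v)" for j v
    using mpow_commute[of N N j] by (simp add: mpow_Suc matrix_vector_mul_assoc)
  have deriv: "(Y (Suc j) has_vector_derivative mat \<mu> *v Y (Suc j) t - Y j t) (at t within {a..b})"
    if t: "t \<in> {a..b}" for j t
  proof -
    let ?f = "\<lambda>t. mat \<mu> *v Y (Suc j) t - Y j t"
    obtain Z where Z: "negligible Z" "\<And>t. t \<in> {a..b} - Z \<Longrightarrow> z t = - (N *v (dz t - mat \<mu> *v z t))"
      using AE_lebesgue_on_negligible[OF dae] by metis
    have f: "?f r = mpow N (Suc j) *v dz r" if "r \<in> {a..b} - Z" for r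
    proof -
      have "N *v dz r = mat \<mu> *v (N *v z r) - z r"
        using Z(2)[OF that] unfolding matrix_vector_mult_diff_distrib mat_vec_commute minus_diff_eq
        by (simp only: eq_diff_eq add.commute)
      then show ?thesis
        unfolding Y_def by (simp add: Suc_step matrix_vector_mult_diff_distrib mat_vec_commute)
    qed
    have Y_int: "Y (Suc j) r = integral {a..r} ?f" if r: "r \<in> {a..b}" for r
    proof -
      have "Y (Suc j) r = integral {a..r} (\<lambda>t. mpow N (Suc j) *v dz t)"
        unfolding Y_def z[OF r]
        using integral_linear[OF integrable_on_subinterval[OF dz] matrix_vector_mul_bounded_linear, of a r "mpow N (Suc j)"] r
        by (simp add: o_def)
      also have "\<dots> = integral {a..r} ?f"
        using f r by (intro integral_spike[OF Z(1)]) auto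
      finally show ?thesis .
    qed
    have "((\<lambda>r. integral {a..r} ?f) has_vector_derivative ?f t) (at t within {a..b})"
      by (intro integral_has_vector_derivative[OF _ t] continuous_intros Y_cont
          bounded_linear.continuous_on[OF matrix_vector_mul_bounded_linear])
    then show ?thesis
      by (rule has_vector_derivative_transform[OF t, rotated]) (rule Y_int)
  qed
  obtain k C where C: "mpow N k = mpow N (Suc k) ** C" "C \<in> span (range (mpow N))"
    using power_recurrence by blast
  have CN: "C ** N = N ** C"
    using span_mpow_commute[OF C(2), of N] by simp
  have Yk: "Y k t = C *v Y (Suc k) t" for t
    unfolding Y_def using C(1) mpow_commute[OF CN, of "Suc k"] by (simp add: matrix_vector_mul_assoc)
  have "Y k t = 0" if "t \<in> {a..b}" for t
  proof (rule linear_ode_zero[where L = "\<lambda>v. (mat \<mu> - C) *v v", OF _ _ _ that])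
    show "bounded_linear (\<lambda>v. (mat \<mu> - C) *v v)" by simp
    show "Y k a = 0"
      using z[of a] ab by (simp add: Y_def)
    fix t assume t: "t \<in> {a..b}"
    have "(Y k has_vector_derivative C *v (mat \<mu> *v Y (Suc k) t - Y k t)) (at t within {a..b})"
      using bounded_linear.has_vector_derivative[OF matrix_vector_mul_bounded_linear deriv[OF t, of k], of C]
      unfolding Yk[symmetric] .
    moreover have "C *v (mat \<mu> *v Y (Suc k) t - Y k t) = (mat \<mu> - C) *v Y k t"
      by (simp only: Yk matrix_vector_mult_diff_distrib matrix_vector_mult_diff_rdistrib mat_vec_commute)
    ultimately show "(Y k has_vector_derivative (mat \<mu> - C) *v Y k t) (at t within {a..b})"
      by simp
  qed
  then have "Y 0 t = 0" if "t \<in> {a..b}" for t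
    using that
  proof (induction k arbitrary: t)
    case (Suc j)
    have "Y j t = 0" if t: "t \<in> {a..b}" for t
    proof -
      have "((\<lambda>_. 0) has_vector_derivative mat \<mu> *v Y (Suc j) t - Y j t) (at t within {a..b})"
        using Suc.prems(1) by (intro has_vector_derivative_transform[OF t _ deriv[OF t, of j]]) auto
      then have "mat \<mu> *v Y (Suc j) t - Y j t = 0"
        using vector_derivative_unique_within_closed_interval[OF ab, of t "\<lambda>_. 0" _ 0] t
        unfolding box_real by (metis has_vector_derivative_const)
      then show ?thesis
        using Suc.prems(1)[OF t] by simp
    qed
    then show ?case
      using Suc by blast
  qed blast
  then show ?thesis
    using s by (simp add: Y_def)
qed

section \<open>Block vectors\<close>

definition upper :: "'a^('r::finite + 's::finite) \<Rightarrow> 'a^'r" where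
  "upper z = (\<chi> i. z $ Inl i)"

definition lower :: "'a^('r::finite + 's::finite) \<Rightarrow> 'a^'s" where
  "lower z = (\<chi> i. z $ Inr i)"

lemma upper_vstack [simp]: "upper (vstack a b) = a"
  and lower_vstack [simp]: "lower (vstack a b) = b"
  by (simp_all add: upper_def lower_def vstack_def)

lemma vstack_upper_lower [simp]: "vstack (upper z) (lower z) = z"
  by (simp add: upper_def lower_def vstack_def vec_eq_iff split: sum.split)

lemma vstack_eq_iff [simp]: "vstack a b = vstack c d \<longleftrightarrow> a = c \<and> b = d"
  by (metis upper_vstack lower_vstack)

lemma vstack_zero [simp]: "vstack 0 0 = (0 :: 'a::zero^('r::finite + 's::finite))"
  by (simp add: vstack_def vec_eq_iff split: sum.split)

lemma vstack_add: "vstack a b + vstack c d = vstack (a + c) (b + d)" for a :: "'a::plus^'r::finite" and b :: "'a^'s::finite"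
  by (simp add: vstack_def vec_eq_iff split: sum.split)

lemma vstack_diff: "vstack a b - vstack c d = vstack (a - c) (b - d)" for a :: "'a::minus^'r::finite" and b :: "'a^'s::finite"
  by (simp add: vstack_def vec_eq_iff split: sum.split)

lemma vstack_uminus: "- vstack a b = vstack (- a) (- b)" for a :: "'a::uminus^'r::finite" and b :: "'a^'s::finite"
  by (simp add: vstack_def vec_eq_iff split: sum.split)

lemma vstack_mult_vec: "vstack A B *v z = vstack (A *v z) (B *v z)"
  for A :: "complex^'c::finite^'r::finite" and B :: "complex^'c^'s::finite"
  by (simp add: vstack_def matrix_vector_mult_def vec_eq_iff split: sum.split)

lemma sum_UNIV_Plus: "(\<Sum>k\<in>UNIV. f k) = (\<Sum>i\<in>UNIV. f (Inl i)) + (\<Sum>j\<in>UNIV. f (Inr j))"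
  for f :: "'c::finite + 'd::finite \<Rightarrow> 'a::comm_monoid_add"
  by (subst UNIV_Plus_UNIV[symmetric], subst sum.Plus) (auto simp: o_def)

lemma hstack_mult_vstack: "hstack A B *v vstack a b = A *v a + B *v b"
  for A :: "complex^'c::finite^'r::finite" and B :: "complex^'d::finite^'r"
  by (simp add: sum_UNIV_Plus vec_eq_iff hstack_def vstack_def matrix_vector_mult_def)

lemma hstack_mult: "hstack A B *v z = A *v upper z + B *v lower z"
  for A :: "complex^'c::finite^'r::finite" and B :: "complex^'d::finite^'r"
  using hstack_mult_vstack[of A B "upper z" "lower z"] by simp

lemma mat_mult_vstack: "mat c *v vstack a b = vstack (mat c *v a) (mat c *v b)"
  for a :: "complex^'r::finite" and b :: "complex^'s::finite"
  by (simp add: mat_vec vstack_def vec_eq_iff split: sum.split)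

lemma lower_mult_vstack:
  "lower (M *v vstack a b) = block_lower_left M *v a + block_lower_right M *v b"
  for M :: "complex^('c::finite + 'd::finite)^('r::finite + 's::finite)"
  by (simp add: sum_UNIV_Plus vec_eq_iff lower_def block_lower_left_def block_lower_right_def vstack_def matrix_vector_mult_def)

lemma bounded_linear_upper: "bounded_linear (upper :: complex^('r::finite + 's::finite) \<Rightarrow> complex^'r)"
  and bounded_linear_lower: "bounded_linear (lower :: complex^('r::finite + 's::finite) \<Rightarrow> complex^'s)"
  unfolding linear_conv_bounded_linear[symmetric]
  by (auto intro!: linearI simp: upper_def lower_def vec_eq_iff)

lemma bounded_linear_vstack_0: "bounded_linear (\<lambda>x. vstack 0 x :: complex^('r::finite + 's::finite))"
  unfolding linear_conv_bounded_linear[symmetric]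
  by (auto intro!: linearI simp: vstack_def vec_eq_iff split: sum.split)

lemma vecs_lower: "z \<in> vecs K \<Longrightarrow> lower z \<in> vecs K"
  by (auto simp: vecs_def lower_def)

section \<open>The optimality system in resolvent form\<close>

lemma invertible_iff_ker: "invertible A \<longleftrightarrow> (\<forall>x. A *v x = 0 \<longrightarrow> x = 0)" for A :: "complex^'n^'n"
  by (simp add: invertible_left_inverse matrix_left_invertible_ker)

lemma matrix_inv_cancel:
  assumes "invertible A"
  shows "A *v (matrix_inv A *v x) = x" "matrix_inv A *v (A *v x) = x"
  using assms by (simp_all add: matrix_vector_mul_assoc matrix_inv_left matrix_inv_right)

text \<open>Schur complement elimination: the first equation is solved for \<open>z\<close>, and what remains for \<open>u\<close> has
  the matrix \<open>T\<close>. The right side is written so that it matches the definitions of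
  \<^const>\<open>N_mu\<close> and \<^const>\<open>M_mu\<close> literally.\<close>

lemma block_elimination:
  fixes H :: "complex^'k^'k" and b :: "complex^'m^'k" and c :: "complex^'k^'m" and S :: "complex^'m^'m"
    and P :: "complex^'k^'k"
  assumes H: "invertible H" and T: "T = S - c ** matrix_inv H ** b" "invertible T"
  shows "H *v z + b *v u = - (P *v y) \<and> c *v z + S *v u = 0 \<longleftrightarrow>
      z = - (((matrix_inv H + matrix_inv H ** b ** matrix_inv T ** c ** matrix_inv H) ** P) *v y) \<and>
      u = - ((- (matrix_inv T ** c ** matrix_inv H ** P)) *v y)"
    (is "?L \<longleftrightarrow> z = - (?N *v y) \<and> u = - (?M *v y)")
proof -
  define G where "G = matrix_inv H"
  define v where "v = matrix_inv T *v (c *v (G *v (P *v y)))"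
  have M: "- (?M *v y) = v"
    by (simp add: v_def G_def matrix_vector_mul_assoc[symmetric] linear_neg[OF bounded_linear.linear[OF bounded_linear_matrix_vec]])
  have N: "- (?N *v y) = - (G *v (P *v y) + G *v (b *v v))"
    by (simp add: v_def G_def matrix_vector_mul_assoc[symmetric] matrix_vector_mult_add_rdistrib)
  have Tv: "T *v x = S *v x - c *v (G *v (b *v x))" for x
    by (simp add: T(1) G_def matrix_vector_mul_assoc[symmetric] matrix_vector_mult_diff_rdistrib)
  have "?L \<longleftrightarrow> z = - (G *v (P *v y) + G *v (b *v v)) \<and> u = v"
  proof
    assume L: ?L
    then have "H *v z = - (P *v y) - b *v u"
      by (simp add: eq_diff_eq)
    then have z: "z = - (G *v (P *v y) + G *v (b *v u))"
      using matrix_inv_cancel(2)[OF H, of z]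
      by (simp add: G_def matrix_vector_mult_diff_distrib linear_neg[OF matrix_vector_mul_linear])
    have "c *v z = - (c *v (G *v (P *v y))) - c *v (G *v (b *v u))"
      unfolding z by (simp add: linear_neg[OF matrix_vector_mul_linear] matrix_vector_right_distrib matrix_vector_mult_diff_distrib)
    moreover have "S *v u = - (c *v z)"
      using L by (simp add: eq_neg_iff_add_eq_0 add.commute)
    ultimately have "T *v u = c *v (G *v (P *v y))"
      by (simp add: Tv)
    then have "u = v"
      unfolding v_def by (metis matrix_inv_cancel(2)[OF T(2)])
    then show "z = - (G *v (P *v y) + G *v (b *v v)) \<and> u = v"
      using z by simp
  next
    assume R: "z = - (G *v (P *v y) + G *v (b *v v)) \<and> u = v"
    have "H *v z = - (P *v y + b *v v)"
      using R by (simp add: G_def matrix_inv_cancel(1)[OF H] linear_neg[OF matrix_vector_mul_linear]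
          matrix_vector_right_distrib matrix_vector_mult_diff_distrib)
    moreover have "S *v v = c *v (G *v (P *v y)) + c *v (G *v (b *v v))"
      using Tv[of v] matrix_inv_cancel(1)[OF T(2)] by (simp add: v_def eq_diff_eq)
    then have "c *v z = - (S *v v)"
      using R by (simp add: linear_neg[OF matrix_vector_mul_linear]
          matrix_vector_right_distrib matrix_vector_mult_diff_distrib)
    ultimately show ?L
      using R by simp
  qed
  then show ?thesis
    by (simp only: M N)
qed

text \<open>The zero block makes the matrix triangular after exchanging the block rows: the kernel equations
  give first \<open>x = 0\<close>, then \<open>l = 0\<close>.\<close>

lemma hamiltonian_block_invertible:
  assumes "\<mu> \<notin> spectrum A" "\<mu> \<notin> spectrum (- ctranspose A)"
  shows "invertible (vstack (hstack 0 (A - mat \<mu>)) (hstack (ctranspose A + mat \<mu>) W))"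
  unfolding invertible_iff_ker
proof (intro allI impI)
  fix z assume "vstack (hstack 0 (A - mat \<mu>)) (hstack (ctranspose A + mat \<mu>) W) *v z = 0"
  then have "vstack ((A - mat \<mu>) *v lower z) ((ctranspose A + mat \<mu>) *v upper z + W *v lower z) = vstack 0 0"
    by (simp add: vstack_mult_vec hstack_mult)
  then have 1: "(A - mat \<mu>) *v lower z = 0" and 2: "(ctranspose A + mat \<mu>) *v upper z + W *v lower z = 0"
    unfolding vstack_eq_iff by auto
  from 1 have "A *v lower z = \<mu> *s lower z"
    by (simp add: matrix_vector_mult_diff_rdistrib mat_vec)
  then have l: "lower z = 0"
    using assms(1) by (auto simp: spectrum_def)
  with 2 have "(- ctranspose A) *v upper z = \<mu> *s upper z"
    by (simp add: matrix_vector_mult_add_rdistrib mat_vec linear_neg[OF bounded_linear.linear[OF bounded_linear_matrix_vec]]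
        neg_eq_iff_add_eq_0 add.commute)
  then have "upper z = 0"
    using assms(2) by (auto simp: spectrum_def)
  with l show "z = 0"
    by (metis vstack_upper_lower vstack_zero)
qed

text \<open>A vector \<open>u\<close> in the kernel of the Schur complement extends to \<open>(l, x, u)\<close> in the kernel of
  \<open>\<mu>E - A\<^sub>S\<close>, by solving the first two block rows for \<open>(l, x)\<close>.\<close>

lemma S_mu_invertible:
  fixes J R Q :: "complex^'n^'n" and B :: "complex^'m^'n"
  assumes mu: "\<mu> \<notin> spectrum ((J - R) ** Q)" "\<mu> \<notin> spectrum (- ctranspose ((J - R) ** Q))"
    and regular: "invertible (mat \<mu> ** E_opt - A_opt J R Q B S)"
  shows "invertible (S_mu J R Q B S \<mu>)"
  unfolding invertible_iff_ker
proof (intro allI impI)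
  fix u assume u: "S_mu J R Q B S \<mu> *v u = 0"
  define A where "A = (J - R) ** Q"
  define W where "W = Q ** R ** Q"
  define z where "z = - (E_mu J R Q \<mu> *v (vstack B 0 *v u))"
  define l x where "l = upper z" and "x = lower z"
  have z_eq: "z = vstack l x" by (simp add: l_def x_def)
  have H: "invertible (vstack (hstack 0 (A - mat \<mu>)) (hstack (ctranspose A + mat \<mu>) W))"
    using hamiltonian_block_invertible[OF mu] by (simp add: A_def)
  have "vstack (hstack 0 (A - mat \<mu>)) (hstack (ctranspose A + mat \<mu>) W) *v z = - (vstack B 0 *v u)"
    unfolding z_def E_mu_def using matrix_inv_cancel(1)[OF H]
    by (simp add: A_def W_def linear_neg[OF matrix_vector_mul_linear])
  then have 1: "(A - mat \<mu>) *v x = - (B *v u)" and 2: "(ctranspose A + mat \<mu>) *v l + W *v x = 0"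
    unfolding z_eq by (simp_all add: vstack_mult_vec hstack_mult_vstack vstack_uminus)
  have "S *v u = hstack (ctranspose B) 0 *v (E_mu J R Q \<mu> *v (vstack B 0 *v u))"
    using u unfolding S_mu_def by (simp add: matrix_vector_mult_diff_rdistrib matrix_vector_mul_assoc[symmetric])
  also have "\<dots> = - (hstack (ctranspose B) 0 *v z)"
    by (simp add: z_def linear_neg[OF matrix_vector_mul_linear])
  also have "hstack (ctranspose B) 0 *v z = ctranspose B *v l"
    unfolding z_eq by (simp add: hstack_mult_vstack)
  finally have 3: "ctranspose B *v l + S *v u = 0"
    by simp
  have "(mat \<mu> ** E_opt - A_opt J R Q B S) *v vstack l (vstack x u) =
     mat \<mu> *v vstack x (vstack (- l) 0)
       - vstack (A *v x + B *v u) (vstack (ctranspose A *v l + W *v x) (ctranspose B *v l + S *v u))"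
    by (simp add: E_opt_def A_opt_def A_def W_def matrix_vector_mult_diff_rdistrib vstack_mult_vec hstack_mult_vstack
       matrix_vector_mul_assoc[symmetric] linear_neg[OF bounded_linear.linear[OF bounded_linear_matrix_vec]])
  also have "\<dots> = 0"
  proof -
    have "mat \<mu> *v x = A *v x + B *v u"
      using 1 by (simp add: matrix_vector_mult_diff_rdistrib algebra_simps)
    moreover have "mat \<mu> *v (- l) = ctranspose A *v l + W *v x"
      using 2 by (simp add: matrix_vector_mult_add_rdistrib linear_neg[OF matrix_vector_mul_linear]
         neg_eq_iff_add_eq_0 add_ac)
    ultimately show ?thesis
      using 3 by (simp add: mat_mult_vstack vstack_diff)
  qed
  finally have "vstack l (vstack x u) = vstack 0 (vstack 0 0)"
    using regular unfolding invertible_iff_ker by simp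
  then show "u = 0"
    unfolding vstack_eq_iff by blast
qed

text \<open>A purely algebraic equivalence, with \<open>dx\<close> and \<open>dl\<close> in place of derivatives. It is applied from left
  to right almost everywhere to a weak solution, and from right to left everywhere to a smooth one.
  Adding \<open>\<mu>\<close> times the skew unit to both sides of the optimality system turns its matrix into the
  one that is inverted in \<^const>\<open>E_mu\<close>, and \<open>(dl, dx)\<close> into \<open>(dl, dx) - \<mu>(l, x)\<close>.\<close>

lemma optimality_dae_iff:
  fixes J R Q :: "complex^'n^'n" and B :: "complex^'m^'n"
  assumes mu: "\<mu> \<notin> spectrum ((J - R) ** Q)" "\<mu> \<notin> spectrum (- ctranspose ((J - R) ** Q))"
    and regular: "invertible (mat \<mu> ** E_opt - A_opt J R Q B S)"
  defines "A \<equiv> (J - R) ** Q" and "W \<equiv> Q ** R ** Q"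
  shows "dx = A *v x + B *v u \<and> dl = - (ctranspose A *v l) - W *v x \<and> ctranspose B *v l + S *v u = 0 \<longleftrightarrow>
      vstack l x = - (N_mu J R Q B S \<mu> *v (vstack dl dx - mat \<mu> *v vstack l x)) \<and>
      u = - (M_mu J R Q B S \<mu> *v (vstack dl dx - mat \<mu> *v vstack l x))"
proof -
  let ?H = "vstack (hstack 0 (A - mat \<mu>)) (hstack (ctranspose A + mat \<mu>) W)"
  let ?z = "vstack l x" and ?y = "vstack dl dx - mat \<mu> *v vstack l x"
  have "?H *v ?z + vstack B 0 *v u = - (skew_unit *v ?y) \<and> hstack (ctranspose B) 0 *v ?z + S *v u = 0 \<longleftrightarrow>
     (A - mat \<mu>) *v x + B *v u = dx - mat \<mu> *v x \<and>
     (ctranspose A + mat \<mu>) *v l + W *v x = - (dl - mat \<mu> *v l) \<and> ctranspose B *v l + S *v u = 0"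
    by (simp add: skew_unit_def vstack_mult_vec hstack_mult_vstack mat_mult_vstack vstack_add vstack_diff vstack_uminus
       linear_neg[OF bounded_linear.linear[OF bounded_linear_matrix_vec]])
  also have "(A - mat \<mu>) *v x + B *v u = dx - mat \<mu> *v x \<longleftrightarrow> dx = A *v x + B *v u"
    by (auto simp: matrix_vector_mult_diff_rdistrib algebra_simps)
  also have "(ctranspose A + mat \<mu>) *v l + W *v x = - (dl - mat \<mu> *v l) \<longleftrightarrow> dl = - (ctranspose A *v l) - W *v x"
    by (auto simp: matrix_vector_mult_add_rdistrib algebra_simps eq_neg_iff_add_eq_0)
  finally have "dx = A *v x + B *v u \<and> dl = - (ctranspose A *v l) - W *v x \<and> ctranspose B *v l + S *v u = 0 \<longleftrightarrow>
     ?H *v ?z + vstack B 0 *v u = - (skew_unit *v ?y) \<and> hstack (ctranspose B) 0 *v ?z + S *v u = 0"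
    by simp
  also have "\<dots> \<longleftrightarrow> ?z = - (N_mu J R Q B S \<mu> *v ?y) \<and> u = - (M_mu J R Q B S \<mu> *v ?y)"
    unfolding N_mu_def M_mu_def E_mu_def A_def W_def
    by (rule block_elimination[OF hamiltonian_block_invertible[OF mu]])
      (use S_mu_invertible[OF mu regular] in \<open>simp_all add: S_mu_def E_mu_def\<close>)
  finally show ?thesis .
qed

text \<open>Over the reals this ensures that the control and the state built from \<open>N\<^sub>\<mu>\<close> and \<open>M\<^sub>\<mu>\<close> are
  admissible, that is, real.\<close>

lemma N_mu_mats:
  fixes J R Q :: "complex^'n^'n" and B :: "complex^'m^'n"
  assumes K: "K = \<real> \<or> K = UNIV" and \<mu>: "\<mu> \<in> K"
    and M: "J \<in> mats K" "R \<in> mats K" "Q \<in> mats K" "B \<in> mats K" "S \<in> mats K"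
    and mu: "\<mu> \<notin> spectrum ((J - R) ** Q)" "\<mu> \<notin> spectrum (- ctranspose ((J - R) ** Q))"
    and regular: "invertible (mat \<mu> ** E_opt - A_opt J R Q B S)"
  shows "N_mu J R Q B S \<mu> \<in> mats K" "M_mu J R Q B S \<mu> \<in> mats K"
proof -
  note sub = subspace_add[OF subspace_mats[OF K]] subspace_diff[OF subspace_mats[OF K]]
    subspace_neg[OF subspace_mats[OF K]] subspace_0[OF subspace_mats[OF K]]
  have one: "mat 1 \<in> mats K"
    using K by (intro mats_mat) auto
  note closed = mats_mult[OF K] mats_ctranspose[OF K] mats_vstack mats_hstack sub mats_mat[OF K \<mu>] one M
  have E: "E_mu J R Q \<mu> \<in> mats K"
    unfolding E_mu_def by (intro matrix_inv_mats[OF K] hamiltonian_block_invertible[OF mu] closed)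
  have B0: "vstack B 0 \<in> mats K"
    by (intro closed)
  have "S_mu J R Q B S \<mu> \<in> mats K"
    unfolding S_mu_def by (intro closed E)
  then have T: "matrix_inv (S_mu J R Q B S \<mu>) \<in> mats K"
    by (rule matrix_inv_mats[OF K _ S_mu_invertible[OF mu regular]])
  show "N_mu J R Q B S \<mu> \<in> mats K" "M_mu J R Q B S \<mu> \<in> mats K"
    unfolding N_mu_def M_mu_def skew_unit_def by (intro closed E T)+
qed

text \<open>\<open>DN\<close> is a projection that commutes with the generator \<open>-D(I - \<mu>N)\<close>, so the flow remains in its
  image, where the generator acts as \<open>\<mu> - D\<close>.\<close>

lemma drazin_flow:
  fixes N :: "complex^'k^'k" and w :: "complex^'k" and \<mu> :: complex and t0 :: real
  defines "D \<equiv> drazin N"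
  assumes z_eq: "\<And>t. z t = mexp (- ((t - t0) *\<^sub>R (D ** (mat 1 - mat \<mu> ** N)))) *v w"
    and w: "w = D ** N *v v"
  shows "(z has_vector_derivative mat \<mu> *v z t - D *v z t) (at t)"
    and "N *v (D *v z t) = z t"
    and "z t0 = w"
proof -
  define G where "G = - (D ** (mat 1 - mat \<mu> ** N))"
  have z: "z = (\<lambda>t. mexp ((t - t0) *\<^sub>R G) *v w)"
    by (simp add: fun_eq_iff z_eq G_def)
  have DN: "D ** N = N ** D" and DND: "D ** N ** D = D"
    unfolding D_def by (rule drazin_properties)+
  have DN': "D *v (N *v x) = N *v (D *v x)" for x
    by (simp add: matrix_vector_mul_assoc DN)
  have DND': "D *v (N *v (D *v x)) = D *v x" for x
    by (metis matrix_vector_mul_assoc DND)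
  have G_vec: "G *v x = mat \<mu> *v (D *v (N *v x)) - D *v x" for x
    by (simp add: G_def matrix_vector_mul_assoc[symmetric] matrix_vector_mult_diff_rdistrib matrix_vector_mult_diff_distrib
        mat_vec_commute linear_neg[OF bounded_linear.linear[OF bounded_linear_matrix_vec]])
  have PG: "(D ** N) ** (r *\<^sub>R G) = (r *\<^sub>R G) ** (D ** N)" for r
  proof -
    have "(D ** N) ** G = G ** (D ** N)"
      by (simp add: matrix_eq matrix_vector_mul_assoc[symmetric] G_vec matrix_vector_mult_diff_distrib mat_vec_commute DN')
    then show ?thesis
      by (simp add: linear_cmul[OF linear_matrix_mult_left] linear_cmul[OF linear_matrix_mult_right])
  qed
  have P: "D *v (N *v z t) = z t" for t
  proof -
    have "(D ** N) *v z t = mexp ((t - t0) *\<^sub>R G) *v ((D ** N) *v w)"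
      unfolding z matrix_vector_mul_assoc by (simp add: mexp_commute[OF PG])
    also have "(D ** N) *v w = w"
      unfolding w by (metis matrix_vector_mul_assoc DND')
    finally show ?thesis
      by (simp add: z matrix_vector_mul_assoc[symmetric])
  qed
  show "N *v (D *v z t) = z t"
    using P[of t] by (simp add: DN')
  show "z t0 = w"
    by (simp add: z mexp_0)
  have "((\<lambda>t. mexp (t *\<^sub>R G)) \<circ> (\<lambda>t. t - t0) has_vector_derivative 1 *\<^sub>R (G ** mexp ((t - t0) *\<^sub>R G))) (at t)"
    by (rule vector_diff_chain_at[OF _ mexp_has_vector_derivative]) (auto intro!: derivative_eq_intros)
  then have "((\<lambda>t. mexp ((t - t0) *\<^sub>R G) *v w) has_vector_derivative (G ** mexp ((t - t0) *\<^sub>R G)) *v w) (at t)"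
    by (intro bounded_linear.has_vector_derivative[OF bounded_linear_matrix_vec]) (simp add: o_def)
  then show "(z has_vector_derivative mat \<mu> *v z t - D *v z t) (at t)"
    using P[of t] G_vec[of "z t"] by (simp add: z matrix_vector_mul_assoc)
qed

section \<open>Sufficiency of the optimality system\<close>

lemma absolutely_integrable_inner_continuous:
  fixes g k :: "real \<Rightarrow> 'a::euclidean_space"
  assumes "g absolutely_integrable_on {a..b}" "continuous_on {a..b} k"
  shows "(\<lambda>t. g t \<bullet> k t) absolutely_integrable_on {a..b}"
proof -
  have "(\<lambda>t. k t \<bullet> g t) absolutely_integrable_on {a..b}"
  proof (rule absolutely_integrable_bounded_measurable_product[where h = "(\<bullet>)"])
    show "bilinear ((\<bullet>) :: 'a \<Rightarrow> 'a \<Rightarrow> real)"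
      using bounded_bilinear_inner by (simp add: bilinear_conv_bounded_bilinear)
    show "k \<in> borel_measurable (lebesgue_on {a..b})"
      using assms(2) by (simp add: continuous_imp_measurable_on_sets_lebesgue)
    show "bounded (k ` {a..b})"
      using assms(2) by (simp add: compact_continuous_image compact_imp_bounded)
  qed (use assms in auto)
  then show ?thesis by (simp add: inner_commute)
qed

lemma continuous_on_matrix_vec [continuous_intros]:
  "continuous_on X f \<Longrightarrow> continuous_on X (\<lambda>t. A *v f t)" for A :: "complex^'c^'r"
  by (rule bounded_linear.continuous_on[OF matrix_vector_mul_bounded_linear])

text \<open>If \<open>q\<close> is not integrable, as may happen for a control that is merely in \<open>L\<^sup>1\<close>, the integral of
  \<open>F + q\<close> is infinite and both claims are trivial. Otherwise they compare \<open>\<integral>f\<close> with \<open>\<integral>f + \<integral>q\<close>.\<close>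

lemma nn_integral_perturbation:
  fixes f F q :: "'a \<Rightarrow> real"
  assumes f: "integrable M f" "\<And>t. t \<in> space M \<Longrightarrow> 0 \<le> f t"
    and F: "integrable M F" "integral\<^sup>L M F = integral\<^sup>L M f"
    and q: "q \<in> borel_measurable M" "\<And>t. t \<in> space M \<Longrightarrow> 0 \<le> q t"
    and nonneg: "\<And>t. t \<in> space M \<Longrightarrow> 0 \<le> F t + q t"
  shows "(\<integral>\<^sup>+t. ennreal (f t) \<partial>M) \<le> (\<integral>\<^sup>+t. ennreal (F t + q t) \<partial>M)"
    and "(\<integral>\<^sup>+t. ennreal (F t + q t) \<partial>M) \<le> (\<integral>\<^sup>+t. ennreal (f t) \<partial>M) \<Longrightarrow> AE t in M. q t = 0"
proof -
  have f_eq: "(\<integral>\<^sup>+t. ennreal (f t) \<partial>M) = ennreal (integral\<^sup>L M f)"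
    using f by (intro nn_integral_eq_integral) auto
  have fin: "integrable M q \<and> (\<integral>\<^sup>+t. ennreal (F t + q t) \<partial>M) = ennreal (integral\<^sup>L M f + integral\<^sup>L M q) \<and> 0 \<le> integral\<^sup>L M q"
    if less: "(\<integral>\<^sup>+t. ennreal (F t + q t) \<partial>M) < \<infinity>"
  proof -
    have sum: "integrable M (\<lambda>t. F t + q t)"
      using F(1) q(1) nonneg less by (intro integrableI_nonneg) auto
    then have "integrable M (\<lambda>t. (F t + q t) - F t)"
      using F(1) by (rule Bochner_Integration.integrable_diff)
    then have "integrable M q" by simp
    moreover have "(\<integral>\<^sup>+t. ennreal (F t + q t) \<partial>M) = ennreal (\<integral>t. F t + q t \<partial>M)"
      using sum nonneg by (intro nn_integral_eq_integral) auto
    moreover have "0 \<le> integral\<^sup>L M q"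
      using q(2) by (intro Bochner_Integration.integral_nonneg) auto
    ultimately show ?thesis
      using F by simp
  qed
  show "(\<integral>\<^sup>+t. ennreal (f t) \<partial>M) \<le> (\<integral>\<^sup>+t. ennreal (F t + q t) \<partial>M)"
  proof (cases "(\<integral>\<^sup>+t. ennreal (F t + q t) \<partial>M) < \<infinity>")
    case True
    then show ?thesis
      using fin f_eq by (simp add: ennreal_leI)
  qed (simp add: less_top[symmetric])
  assume le: "(\<integral>\<^sup>+t. ennreal (F t + q t) \<partial>M) \<le> (\<integral>\<^sup>+t. ennreal (f t) \<partial>M)"
  then have "(\<integral>\<^sup>+t. ennreal (F t + q t) \<partial>M) < \<infinity>"
    using f_eq by (simp add: le_less_trans)
  with fin have q': "integrable M q" "0 \<le> integral\<^sup>L M q"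
    "ennreal (integral\<^sup>L M f + integral\<^sup>L M q) \<le> ennreal (integral\<^sup>L M f)"
    using le f_eq by auto
  moreover have "0 \<le> integral\<^sup>L M f"
    using f(2) by (intro Bochner_Integration.integral_nonneg) auto
  ultimately have "integral\<^sup>L M q = 0"
    by (simp add: ennreal_le_iff)
  then show "AE t in M. q t = 0"
    using integral_nonneg_eq_0_iff_AE[OF q'(1)] q(2) by auto
qed

lemma quadratic_form_expand:
  fixes W :: "complex^'n^'n"
  assumes "ctranspose W = W"
  shows "y \<bullet> (W *v y) = x \<bullet> (W *v x) + 2 * ((y - x) \<bullet> (W *v x)) + (y - x) \<bullet> (W *v (y - x))"
proof -
  have "x \<bullet> (W *v y) = y \<bullet> (W *v x)"
    by (metis assms inner_ctranspose inner_commute)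
  then show ?thesis
    by (simp add: matrix_vector_mult_diff_distrib inner_diff_left inner_diff_right)
qed

text \<open>The pair \<open>(x, u)\<close> satisfies the optimality system with adjoint state \<open>l\<close>; the competitor \<open>(y, v)\<close> is
  merely a weak solution of the state equation with the same end points. Since \<open>Su = -B\<^sup>Hl\<close> and
  \<open>Wx = -l' - A\<^sup>Hl\<close>, the cross term \<open>(y - x)\<^sup>HWx + (v - u)\<^sup>HSu\<close> has the real part of
  \<open>-((y - x)\<^sup>Hl)'\<close>, whose integral is zero. Positivity is assumed on subspaces \<open>X\<close> and \<open>U\<close> of
  states and controls, to cover \<open>K\<^sup>n\<close> and \<open>K\<^sup>m\<close> in both cases of \<open>K\<close>.\<close>

lemma lq_verification:
  fixes A W :: "complex^'n^'n" and B :: "complex^'m^'n" and S :: "complex^'m^'m"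
    and x l y dy :: "real \<Rightarrow> complex^'n" and u v :: "real \<Rightarrow> complex^'m"
  assumes ab: "a < b"
    and W: "ctranspose W = W" "\<And>z. z \<in> X \<Longrightarrow> 0 \<le> z \<bullet> (W *v z)" and X: "subspace X"
    and S: "ctranspose S = S" "\<And>z. z \<in> U \<Longrightarrow> 0 \<le> z \<bullet> (S *v z)" and U: "subspace U"
    and x: "\<And>t. (x has_vector_derivative A *v x t + B *v u t) (at t)" "\<And>t. t \<in> {a..b} \<Longrightarrow> x t \<in> X"
    and u: "continuous_on UNIV u" "\<And>t. t \<in> {a..b} \<Longrightarrow> u t \<in> U"
    and l: "\<And>t. (l has_vector_derivative - (ctranspose A *v l t) - W *v x t) (at t)"
    and stat: "\<And>t. ctranspose B *v l t + S *v u t = 0"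
    and y: "continuous_on {a..b} y" "\<And>t. t \<in> {a..b} \<Longrightarrow> y t \<in> X"
    and v: "v absolutely_integrable_on {a..b}" "\<And>t. t \<in> {a..b} \<Longrightarrow> v t \<in> U"
    and dy: "dy absolutely_integrable_on {a..b}" "has_weak_derivative y dy a b"
    and ode: "AE t in lebesgue_on {a..b}. dy t = A *v y t + B *v v t"
    and ends: "y a = x a" "y b = x b"
  defines "f \<equiv> \<lambda>y v t. y t \<bullet> (W *v y t) + v t \<bullet> (S *v v t)"
  shows "(\<integral>\<^sup>+t. ennreal (f x u t) \<partial>lebesgue_on {a..b}) \<le> (\<integral>\<^sup>+t. ennreal (f y v t) \<partial>lebesgue_on {a..b})"
    and "(\<integral>\<^sup>+t. ennreal (f y v t) \<partial>lebesgue_on {a..b}) \<le> (\<integral>\<^sup>+t. ennreal (f x u t) \<partial>lebesgue_on {a..b}) \<Longrightarrow>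
      AE t in lebesgue_on {a..b}. f (\<lambda>t. y t - x t) (\<lambda>t. v t - u t) t = 0"
proof -
  let ?M = "lebesgue_on {a..b}"
  have meas: "{a..b} \<in> sets lebesgue"
    using lmeasurable_cbox[of a b] by (simp add: fmeasurableD)
  define q where "q = f (\<lambda>t. y t - x t) (\<lambda>t. v t - u t)"
  define c where "c t = (y t - x t) \<bullet> (W *v x t) + (v t - u t) \<bullet> (S *v u t)" for t
  have x_cont: "continuous_on T x" and l_cont: "continuous_on T l" for T
    using x(1) l by (auto intro!: continuous_at_imp_continuous_on has_vector_derivative_continuous)
  have u_cont: "continuous_on T u" for T
    using u(1) continuous_on_subset by blast
  have u_int: "u absolutely_integrable_on {a..b}"
    by (rule absolutely_integrable_continuous_real[OF u_cont])
  have dv: "(\<lambda>t. v t - u t) absolutely_integrable_on {a..b}"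
    by (rule set_integral_diff(1)[OF v(1) u_int])
  \<comment> \<open>The exact second order expansion of the quadratic cost about \<open>(x, u)\<close>.\<close>
  have f_expand: "f y v t = (f x u t + 2 * c t) + q t" for t
    unfolding f_def c_def q_def
    using quadratic_form_expand[OF W(1), of "y t" "x t"] quadratic_form_expand[OF S(1), of "v t" "u t"] by simp
  have c_int: "c absolutely_integrable_on {a..b}"
    unfolding c_def
    by (intro set_integral_add absolutely_integrable_inner_continuous dv absolutely_integrable_continuous_real
        continuous_intros y x_cont u_cont)
  have f_int: "f x u absolutely_integrable_on {a..b}"
    unfolding f_def by (intro absolutely_integrable_continuous_real continuous_intros x_cont u_cont)
  have c_zero: "integral {a..b} c = 0"
  proof -
    let ?dx = "\<lambda>t. A *v x t + B *v u t" and ?dl = "\<lambda>t. - (ctranspose A *v l t) - W *v x t"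
    have dx_cont: "continuous_on T ?dx" for T
      by (intro continuous_intros x_cont u_cont)
    have dx_int: "?dx absolutely_integrable_on {a..b}"
      by (rule absolutely_integrable_continuous_real[OF dx_cont])
    have "has_weak_derivative (\<lambda>t. y t - x t) (\<lambda>t. dy t - ?dx t) a b"
      by (rule has_weak_derivative_diff[OF y(1) dy x_cont dx_int has_weak_derivative_C1[OF x(1) dx_cont]])
        (use ab in simp)
    then have parts: "((\<lambda>t. (y t - x t) \<bullet> ?dl t + (dy t - ?dx t) \<bullet> l t) has_integral
        (y b - x b) \<bullet> l b - (y a - x a) \<bullet> l a) {a..b}"
      using dx_int by (intro weak_derivative_inner_by_parts ab continuous_on_diff y x_cont set_integral_diff(1) dy l
          continuous_intros l_cont)
    obtain Z where Z: "negligible Z" "\<And>t. t \<in> {a..b} - Z \<Longrightarrow> dy t = A *v y t + B *v v t"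
      using AE_lebesgue_on_negligible[OF ode] by metis
    have "- c t = (y t - x t) \<bullet> ?dl t + (dy t - ?dx t) \<bullet> l t" if "t \<in> {a..b} - Z" for t
    proof -
      have "dy t - ?dx t = A *v (y t - x t) + B *v (v t - u t)"
        using Z(2)[OF that] by (simp add: matrix_vector_mult_diff_distrib)
      moreover have "S *v u t = - (ctranspose B *v l t)"
        using stat[of t] by (simp add: eq_neg_iff_add_eq_0 add.commute)
      moreover have "(A *v p) \<bullet> l t = p \<bullet> (ctranspose A *v l t)" "(B *v r) \<bullet> l t = r \<bullet> (ctranspose B *v l t)" for p r
        by (metis inner_ctranspose inner_commute)+
      ultimately show ?thesis
        unfolding c_def by (simp add: inner_add_left inner_diff_right)
    qed
    then have "((\<lambda>t. - c t) has_integral (y b - x b) \<bullet> l b - (y a - x a) \<bullet> l a) {a..b}"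
      by (rule has_integral_spike[OF Z(1) _ parts])
    then have "((\<lambda>t. - c t) has_integral 0) {a..b}"
      using ends by simp
    then show ?thesis
      using integral_unique[OF has_integral_neg] by force
  qed
  have q_nonneg: "0 \<le> q t" if "t \<in> {a..b}" for t
    unfolding q_def f_def using that
    by (intro add_nonneg_nonneg W S subspace_diff[OF X] subspace_diff[OF U] x y u v)
  have y_meas: "y \<in> borel_measurable ?M" and x_meas: "x \<in> borel_measurable ?M"
    using y(1) x_cont meas by (auto intro: continuous_imp_measurable_on_sets_lebesgue)
  have dv_meas: "(\<lambda>t. v t - u t) \<in> borel_measurable ?M"
    using dv meas by (rule absolutely_integrable_imp_borel_measurable)
  have mult_meas: "(\<lambda>t. P *v g t) \<in> borel_measurable ?M" if "g \<in> borel_measurable ?M" for P :: "complex^'k^'k" and g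
    using that by (intro borel_measurable_continuous_on[where f = "(*v) P"] linear_continuous_on) auto
  have q_meas: "q \<in> borel_measurable ?M"
    unfolding q_def f_def
    by (intro borel_measurable_add borel_measurable_inner mult_meas dv_meas borel_measurable_diff y_meas x_meas)
  have fI: "integrable ?M (f x u)" and cI: "integrable ?M c"
    using f_int c_int meas by (auto intro: absolutely_integrable_imp_integrable)
  have "integral\<^sup>L ?M c = 0"
    using lebesgue_integral_eq_integral[OF cI meas] c_zero by simp
  then have F: "integrable ?M (\<lambda>t. f x u t + 2 * c t)" "(\<integral>t. f x u t + 2 * c t \<partial>?M) = integral\<^sup>L ?M (f x u)"
    using fI cI by auto
  have f_nonneg: "0 \<le> f x u t" "0 \<le> f y v t" if "t \<in> {a..b}" for t
    unfolding f_def using that by (auto intro!: add_nonneg_nonneg W S x y u v)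
  note perturb = nn_integral_perturbation[OF fI _ F q_meas]
  show "(\<integral>\<^sup>+t. ennreal (f x u t) \<partial>?M) \<le> (\<integral>\<^sup>+t. ennreal (f y v t) \<partial>?M)"
    unfolding f_expand by (rule perturb(1)) (use f_nonneg q_nonneg f_expand in auto)
  assume "(\<integral>\<^sup>+t. ennreal (f y v t) \<partial>?M) \<le> (\<integral>\<^sup>+t. ennreal (f x u t) \<partial>?M)"
  then have "AE t in ?M. q t = 0"
    unfolding f_expand by (intro perturb(2)) (use f_nonneg q_nonneg f_expand in auto)
  then show "AE t in ?M. f (\<lambda>t. y t - x t) (\<lambda>t. v t - u t) t = 0"
    by (simp add: q_def)
qed

section \<open>The optimal control\<close>

theorem corollary4p4:
  fixes K :: "complex set"
    and t0 t1 :: real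
    and x0 x1 :: "complex^'n"
    and J R Q :: "complex^'n^'n"
    and B :: "complex^'m^'n"
    and S :: "complex^'m^'m"
    and \<mu> :: complex
    and N :: "complex^('n + 'n)^('n + 'n)"
    and \<Phi> :: "real \<Rightarrow> complex^('n + 'n)^('n + 'n)"
    and E3 E4 :: "real \<Rightarrow> complex^'n^'n"
    and w :: "complex^('n + 'n)"
    and u :: "real \<Rightarrow> complex^'m"
  assumes K: "K = \<real> \<or> K = UNIV"
    and t: "t0 < t1"
    and x: "x0 \<in> vecs K" "x1 \<in> vecs K"
    and Sigma: "(J, R, Q, B) \<in> Sigma_set K"
    and S: "S \<in> mats K" "ctranspose S = S" "psd K S"
    and mu: "\<mu> \<in> K - (spectrum ((J - R) ** Q) \<union> spectrum (- ctranspose ((J - R) ** Q)))"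
    and regular: "invertible (mat \<mu> ** E_opt - A_opt J R Q B S)"
    and N: "N = N_mu J R Q B S \<mu>"
    and Phi: "\<And>t. \<Phi> t = mexp (- ((t - t0) *\<^sub>R (drazin N ** (mat 1 - mat \<mu> ** N))))"
    and E3: "\<And>t. E3 t = block_lower_left (\<Phi> t)"
    and E4: "\<And>t. E4 t = block_lower_right (\<Phi> t)"
    and E3_inv: "invertible (E3 t1)"
    and w: "w = vstack (matrix_inv (E3 t1) *v (x1 - E4 t1 *v x0)) x0"
    and w_im: "w \<in> (\<lambda>v. (drazin N ** N) *v v) ` vecs K"
    and u: "\<And>t. u t = (M_mu J R Q B S \<mu> ** drazin N ** \<Phi> t) *v w"
  shows "optimal_control K t0 t1 x0 x1 J R Q B S u \<and>
    (\<forall>v. optimal_control K t0 t1 x0 x1 J R Q B S v \<longrightarrow>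
       (AE t in lebesgue_on {t0..t1}. v t = u t))"
proof -
  define A where "A = (J - R) ** Q"
  define W where "W = Q ** R ** Q"
  define M where "M = M_mu J R Q B S \<mu>"
  define D where "D = drazin N"
  from Sigma have JRQB: "J \<in> mats K" "R \<in> mats K" "Q \<in> mats K" "B \<in> mats K"
    and R: "ctranspose R = R" "psd K R" and Q: "ctranspose Q = Q"
    by (auto simp: Sigma_set_def)
  have \<mu>: "\<mu> \<in> K" "\<mu> \<notin> spectrum ((J - R) ** Q)" "\<mu> \<notin> spectrum (- ctranspose ((J - R) ** Q))"
    using mu by auto
  note dae_iff = optimality_dae_iff[OF \<mu>(2,3) regular, folded A_def W_def N M_def]
  have NM: "N \<in> mats K" "M \<in> mats K"
    unfolding N M_def using N_mu_mats[OF K \<mu>(1) JRQB S(1) \<mu>(2,3) regular] by auto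
  have D_mats: "D \<in> mats K"
    unfolding D_def by (rule drazin_mats[OF K NM(1)])
  have A_mats: "A \<in> mats K"
    unfolding A_def by (intro mats_mult[OF K] subspace_diff[OF subspace_mats[OF K]] JRQB)
  have W_mats: "W \<in> mats K"
    unfolding W_def by (intro mats_mult[OF K] JRQB)
  have W_herm: "ctranspose W = W"
    by (simp add: W_def ctranspose_mult R Q matrix_mul_assoc)
  have W_cinner: "cinner x (W *v x) = cinner (Q *v x) (R *v (Q *v x))" for x
    unfolding W_def matrix_vector_mul_assoc[symmetric] cinner_ctranspose[of x Q] Q ..
  have W_psd: "psd K W"
    using R(2) mats_mult_vec[OF K JRQB(3)] by (simp add: psd_def W_cinner)
  have \<Phi>_mats: "\<Phi> s \<in> mats K" for s
  proof -
    have "mat 1 \<in> mats K"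
      using K by (intro mats_mat) auto
    then show ?thesis
      unfolding Phi D_def[symmetric]
      by (intro mexp_mats[OF K] subspace_neg[OF subspace_mats[OF K]] subspace_scale[OF subspace_mats[OF K]]
          mats_mult[OF K] subspace_diff[OF subspace_mats[OF K]] D_mats NM mats_mat[OF K \<mu>(1)])
  qed
  obtain w' where w': "w' \<in> vecs K" "w = D ** N *v w'"
    using w_im by (auto simp: D_def)
  have w_vecs: "w \<in> vecs K"
    unfolding w'(2) by (intro mats_mult_vec[OF K] mats_mult[OF K] D_mats NM w')
  define z where "z t = \<Phi> t *v w" for t
  have "z t = mexp (- ((t - t0) *\<^sub>R (drazin N ** (mat 1 - mat \<mu> ** N)))) *v w" for t
    by (simp add: z_def Phi)
  note flow = drazin_flow[where z = z, OF this w'(2)[unfolded D_def], folded D_def]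
  define l where "l t = upper (z t)" for t
  define xs where "xs t = lower (z t)" for t
  define dz where "dz t = mat \<mu> *v z t - D *v z t" for t
  have u_eq: "u t = M *v (D *v z t)" for t
    by (simp add: u M_def D_def z_def matrix_vector_mul_assoc[symmetric])
  have "z t = - (N *v (dz t - mat \<mu> *v z t)) \<and> u t = - (M *v (dz t - mat \<mu> *v z t))" for t
    using flow(2)[of t] by (simp add: dz_def u_eq linear_neg[OF matrix_vector_mul_linear])
  then have dae: "lower (dz t) = A *v xs t + B *v u t \<and> upper (dz t) = - (ctranspose A *v l t) - W *v xs t
      \<and> ctranspose B *v l t + S *v u t = 0" for t
    using dae_iff[of "lower (dz t)" "xs t" "u t" "upper (dz t)" "l t"] by (simp add: l_def xs_def)
  have xs_deriv: "(xs has_vector_derivative A *v xs t + B *v u t) (at t)" for t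
    using bounded_linear.has_vector_derivative[OF bounded_linear_lower flow(1)[of t]] dae[of t]
    by (simp add: xs_def[abs_def] dz_def)
  have l_deriv: "(l has_vector_derivative - (ctranspose A *v l t) - W *v xs t) (at t)" for t
    using bounded_linear.has_vector_derivative[OF bounded_linear_upper flow(1)[of t]] dae[of t]
    by (simp add: l_def[abs_def] dz_def)
  have z_cont: "continuous_on T z" for T
    using flow(1) by (auto intro!: continuous_at_imp_continuous_on has_vector_derivative_continuous)
  have xs_cont: "continuous_on T xs" for T
    using xs_deriv by (auto intro!: continuous_at_imp_continuous_on has_vector_derivative_continuous)
  have u_cont: "continuous_on T u" for T
    unfolding u_eq[abs_def] by (intro continuous_intros z_cont)
  have z_vecs: "z s \<in> vecs K" for s
    unfolding z_def by (rule mats_mult_vec[OF K \<Phi>_mats w_vecs])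
  have xs_vecs: "xs s \<in> vecs K" for s
    unfolding xs_def by (rule vecs_lower[OF z_vecs])
  have u_vecs: "u s \<in> vecs K" for s
    unfolding u_eq by (intro mats_mult_vec[OF K] NM D_mats z_vecs)
  have xs_t0: "xs t0 = x0"
    using flow(3) by (simp add: xs_def w)
  \<comment> \<open>This is what the upper half of \<open>w\<close> is made for.\<close>
  have xs_t1: "xs t1 = x1"
    unfolding xs_def z_def w lower_mult_vstack E3[symmetric] E4[symmetric]
    by (simp add: matrix_inv_cancel(1)[OF E3_inv])
  define dx where "dx t = A *v xs t + B *v u t" for t
  have dx_cont: "continuous_on T dx" for T
    unfolding dx_def by (intro continuous_intros xs_cont u_cont)
  have dx_vecs: "dx s \<in> vecs K" for s
    unfolding dx_def by (intro subspace_add[OF subspace_vecs[OF K]] mats_mult_vec[OF K] A_mats JRQB xs_vecs u_vecs)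
  have dx_weak: "has_weak_derivative xs dx t0 t1"
    by (rule has_weak_derivative_C1) (use xs_deriv dx_cont t in \<open>auto simp: dx_def\<close>)
  have L1_cont: "f \<in> L1 K t0 t1" if "\<And>T. continuous_on T f" "\<And>s. f s \<in> vecs K" for f :: "real \<Rightarrow> complex^'k"
    using that by (simp add: L1_def absolutely_integrable_continuous_real)
  have feasible_u: "feasible K t0 t1 x0 x1 J R Q B xs u"
  proof -
    have dx_L1: "dx \<in> L1 K t0 t1"
      by (rule L1_cont[OF dx_cont dx_vecs])
    then have "xs \<in> W11 K t0 t1"
      using L1_cont[OF xs_cont xs_vecs] xs_cont dx_weak by (auto simp: W11_def)
    moreover have "AE t in lebesgue_on {t0..t1}. dx t = A *v xs t + B *v u t"
      by (simp add: dx_def)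
    ultimately show ?thesis
      unfolding feasible_def A_def[symmetric]
      using L1_cont[OF u_cont u_vecs] dx_L1 dx_weak xs_t0 xs_t1 by blast
  qed
  have cost: "cost t0 t1 R Q S y v = 1 / 2 * (\<integral>\<^sup>+t. ennreal (y t \<bullet> (W *v y t) + v t \<bullet> (S *v v t)) \<partial>lebesgue_on {t0..t1})" for y v
    by (simp add: cost_def Re_cinner W_def)
  have half: "1 / 2 * p \<le> 1 / 2 * q \<longleftrightarrow> p \<le> q" for p q :: ennreal
    by (rule ennreal_mult_le_mult_iff) (simp_all add: ennreal_divide_eq_top_iff)
  have compare: "cost t0 t1 R Q S xs u \<le> cost t0 t1 R Q S y v"
    "cost t0 t1 R Q S y v \<le> cost t0 t1 R Q S xs u \<Longrightarrow> AE t in lebesgue_on {t0..t1}. v t = u t"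
    if feas: "feasible K t0 t1 x0 x1 J R Q B y v" for y v
  proof -
    from feas obtain dy where v: "v absolutely_integrable_on {t0..t1}" "\<And>t. t \<in> {t0..t1} \<Longrightarrow> v t \<in> vecs K"
      and y: "continuous_on {t0..t1} y" "\<And>t. t \<in> {t0..t1} \<Longrightarrow> y t \<in> vecs K"
      and dy: "dy absolutely_integrable_on {t0..t1}" "has_weak_derivative y dy t0 t1"
      and ode: "AE t in lebesgue_on {t0..t1}. dy t = A *v y t + B *v v t"
      and ends: "y t0 = xs t0" "y t1 = xs t1"
      by (auto simp: feasible_def L1_def W11_def A_def xs_t0 xs_t1)
    have stat: "ctranspose B *v l t + S *v u t = 0" for t
      using dae by blast
    note verif = lq_verification[OF t W_herm psd_inner[OF W_psd] subspace_vecs[OF K] S(2) psd_inner[OF S(3)]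
        subspace_vecs[OF K] xs_deriv xs_vecs u_cont u_vecs l_deriv stat y v dy ode ends]
    show "cost t0 t1 R Q S xs u \<le> cost t0 t1 R Q S y v"
      unfolding cost half by (rule verif(1))
    assume "cost t0 t1 R Q S y v \<le> cost t0 t1 R Q S xs u"
    then have q0: "AE t in lebesgue_on {t0..t1}. (y t - xs t) \<bullet> (W *v (y t - xs t)) + (v t - u t) \<bullet> (S *v (v t - u t)) = 0"
      unfolding cost half by - (rule verif(2))
    define p where "p t = y t - xs t" for t
    define r where "r t = v t - u t" for t
    define dp where "dp t = dy t - dx t" for t
    \<comment> \<open>Equality of the costs puts the difference of the two pairs into the kernels of \<open>W\<close> and \<open>S\<close>. So it solves the optimality system with adjoint state zero.\<close>
    have ker: "AE t in lebesgue_on {t0..t1}. W *v p t = 0 \<and> S *v r t = 0 \<and> dp t = A *v p t + B *v r t"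
      using q0 ode AE_space
    proof eventually_elim
      case (elim s)
      then have s: "s \<in> {t0..t1}" by simp
      have p: "p s \<in> vecs K" and r: "r s \<in> vecs K"
        unfolding p_def r_def by (intro subspace_diff[OF subspace_vecs[OF K]] y(2)[OF s] v(2)[OF s] xs_vecs u_vecs)+
      have "p s \<bullet> (W *v p s) = 0" "r s \<bullet> (S *v r s) = 0"
        using elim(1) psd_inner[OF W_psd p] psd_inner[OF S(3) r] by (simp_all add: p_def r_def)
      then have "W *v p s = 0" "S *v r s = 0"
        using psd_kernel[OF K W_mats W_herm W_psd p] psd_kernel[OF K S r] by auto
      moreover have "dp s = A *v p s + B *v r s"
        using elim(2) by (simp add: dp_def dx_def p_def r_def matrix_vector_mult_diff_distrib)
      ultimately show ?case by blast
    qed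
    have dp_int: "dp absolutely_integrable_on {t0..t1}"
      unfolding dp_def by (intro set_integral_diff(1) dy absolutely_integrable_continuous_real dx_cont)
    have p_cont: "continuous_on {t0..t1} p"
      unfolding p_def by (intro continuous_on_diff y xs_cont)
    have p_weak: "has_weak_derivative p dp t0 t1"
      unfolding p_def dp_def
      by (rule has_weak_derivative_diff[OF y(1) dy xs_cont absolutely_integrable_continuous_real[OF dx_cont] dx_weak])
    have p_int: "p t = integral {t0..t} dp" if "t \<in> {t0..t1}" for t
      using weak_derivative_integral[OF p_cont dp_int p_weak that] ends by (simp add: p_def)
    have dp_HK: "dp integrable_on {t0..t1}"
      using dp_int by (rule set_lebesgue_integral_eq_integral(1))
    have p_zero: "p t = 0" if "t \<in> {t0..t1}" for t
    proof -
      have "vstack 0 (p t) = (0 :: complex^('n + 'n))"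
      proof (rule homogeneous_dae_zero[where z = "\<lambda>t. vstack 0 (p t)" and dz = "\<lambda>t. vstack 0 (dp t)" and N = N and \<mu> = \<mu>, OF t _ _ _ _ that])
        show "continuous_on {t0..t1} (\<lambda>t. vstack 0 (p t) :: complex^('n + 'n))"
          by (rule bounded_linear.continuous_on[OF bounded_linear_vstack_0 p_cont])
        show "(\<lambda>t. vstack 0 (dp t) :: complex^('n + 'n)) integrable_on {t0..t1}"
          using integrable_linear[OF dp_HK bounded_linear_vstack_0] by (simp add: o_def)
        show "(vstack 0 (p s) :: complex^('n + 'n)) = integral {t0..s} (\<lambda>t. vstack 0 (dp t))" if s: "s \<in> {t0..t1}" for s
          using integral_linear[OF integrable_on_subinterval[OF dp_HK] bounded_linear_vstack_0[where 'r = 'n], of t0 s] s p_int[OF s]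
          by (simp add: o_def)
        show "AE t in lebesgue_on {t0..t1}. (vstack 0 (p t) :: complex^('n + 'n)) =
            - (N *v (vstack 0 (dp t) - mat \<mu> *v vstack 0 (p t)))"
          using ker
        proof eventually_elim
          case (elim s)
          then show ?case
            using dae_iff[of "dp s" "p s" "r s" 0 0] by simp
        qed
      qed
      then show ?thesis
        by (metis vstack_eq_iff vstack_zero)
    qed
    \<comment> \<open>With \<open>y = x\<close>, only the controls may still differ; their difference is recovered from \<open>dp = 0\<close> by the resolvent form.\<close>
    have "AE t in lebesgue_on {t0..t1}. dp t = 0"
      by (rule AE_zero_of_integral_zero[OF dp_HK]) (use p_int p_zero in auto)
    with ker AE_space show "AE t in lebesgue_on {t0..t1}. v t = u t"
    proof eventually_elim
      case (elim s)
      then have "p s = 0" using p_zero by simp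
      then have "r s = 0"
        using dae_iff[of 0 0 "r s" 0 0] elim by simp
      then show ?case by (simp add: r_def)
    qed
  qed
  have "optimal_control K t0 t1 x0 x1 J R Q B S u"
    unfolding optimal_control_def using feasible_u compare(1) by blast
  moreover have "AE t in lebesgue_on {t0..t1}. v t = u t" if v: "optimal_control K t0 t1 x0 x1 J R Q B S v" for v
    using v feasible_u compare(2) unfolding optimal_control_def by blast
  ultimately show ?thesis by blast
qed

end
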